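(* If $G$ is a connected graph on an even number $n\geq 4$ of vertices with $q(G)=2$ and $|E(G)|=2n-4$, then $G$ is isomorphic to $Q_3$ or to the double-ended candle $G_{n/2}$.
   Context: For a graph $G$ on $n$ vertices, $\mathcal{S}(G)$ is the set of real symmetric $n\times n$ matrices $A=[a_{ij}]$ with $a_{ij}\neq0$ for $i\ne j$ iff $\{i,j\}\in E(G)$ (diagonal unrestricted); $q(G)$ is the minimum number of distinct eigenvalues of a matrix in $\mathcal{S}(G)$. $Q_3$ is the 3-dimensional cube graph. Double-ended candle: for $k\geq 2$, $G_k$ is the graph on $\{1,\dots,2k\}$ with levels $L_0=\{1\}$, $L_i=\{2i,2i+1\}$ ($1\le i\le k-1$), $L_k=\{2k\}$, two vertices adjacent iff they lie in consecutive levels. *)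

theory Defs
  imports "Jordan_Normal_Form.Char_Poly"
begin

text \<open>A simple graph on vertex set {0..<n}, given by its set of 2-element edges.\<close>
definition is_graph :: "nat \<Rightarrow> nat set set \<Rightarrow> bool" where
  "is_graph n E \<longleftrightarrow> (\<forall>e\<in>E. \<exists>i j. i < n \<and> j < n \<and> i \<noteq> j \<and> e = {i, j})"

definition graph_connected :: "nat \<Rightarrow> nat set set \<Rightarrow> bool" where
  "graph_connected n E \<longleftrightarrow>
     (\<forall>u<n. \<forall>v<n. (u, v) \<in> {(a, b). {a, b} \<in> E}\<^sup>*)"

text \<open>S(G): real symmetric n x n matrices whose off-diagonal nonzero pattern is E.\<close>
definition sym_pattern :: "nat \<Rightarrow> nat set set \<Rightarrow> real mat set" where
  "sym_pattern n E = {A. A \<in> carrier_mat n n \<and> A\<^sup>T = A \<and>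
      (\<forall>i<n. \<forall>j<n. i \<noteq> j \<longrightarrow> (A $$ (i, j) \<noteq> 0 \<longleftrightarrow> {i, j} \<in> E))}"

text \<open>q(G): minimum number of distinct eigenvalues of a matrix in S(G).\<close>
definition q_graph :: "nat \<Rightarrow> nat set set \<Rightarrow> nat" where
  "q_graph n E = (LEAST k. \<exists>A\<in>sym_pattern n E. card {x. eigenvalue A x} = k)"

definition graph_iso :: "nat \<Rightarrow> nat set set \<Rightarrow> nat \<Rightarrow> nat set set \<Rightarrow> bool" where
  "graph_iso n E m F \<longleftrightarrow> (\<exists>f. bij_betw f {0..<n} {0..<m} \<and>
      (\<forall>u<n. \<forall>v<n. {u, v} \<in> E \<longleftrightarrow> {f u, f v} \<in> F))"

text \<open>The cube Q_3 on vertices 0..7 (binary strings of length 3); adjacent iff they differ in exactly one bit.\<close>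
definition Q3_edges :: "nat set set" where
  "Q3_edges = {{u, v} | u v. u < 8 \<and> v < 8 \<and>
      card {i. i < (3::nat) \<and> odd (u div 2 ^ i) \<noteq> odd (v div 2 ^ i)} = 1}"

text \<open>Double-ended candle G_k on vertices 0..2k-1 (vertex v here is vertex v+1 of the paper);
  paper vertex x lies in level x div 2, so vertex v lies in level (v+1) div 2.\<close>
definition candle_edges :: "nat \<Rightarrow> nat set set" where
  "candle_edges k = {{u, v} | u v. u < 2 * k \<and> v < 2 * k \<and> (u + 1) div 2 = (v + 1) div 2 + 1}"

end

theory Submission
  imports Defs "Jordan_Normal_Form.Spectral_Radius"
begin

text \<open>A symmetric matrix with eigenvalues \<open>a\<close>, \<open>b\<close> only satisfies \<open>(A - a)(A - b) = 0\<close>, so the rows of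
  nonadjacent vertices have vanishing inner product over their common neighbours. Hence nonadjacent
  vertices with a common neighbour have a second one. In the distance levels of a root of degree
  \<open>d\<close>, every vertex at distance at least 2 therefore has at least two predecessors, and counting
  edges gives \<open>|E| = 2n - 2 - d + excess\<close>, where the excess counts the surplus predecessors and the
  edges inside levels.

  If some vertex has degree 2, the excess from any vertex of degree 2 is 0. Were a level to have three
  vertices while the preceding one is \<open>{a, b}\<close>, their rows restricted to \<open>a\<close>, \<open>b\<close> would be parallel, so
  any two of them would share a successor; the levels seen from a vertex in the last level contradict
  this. So all levels but the extreme ones have two vertices.

  Otherwise \<open>|E| = 2n - 4\<close> yields a vertex of degree 3, and the excess from it is 1. Looking down from
  the last level, either some level consists of two vertices with a common successor, which forces the root
  to have degree 2, or the graph is the cube.\<close>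

section \<open>Symmetric matrices with two eigenvalues\<close>

text \<open>The Hermitian form \<open>T\<close> of an eigenvector equals its own conjugate and is
  \<open>z\<close> times the positive number \<open>S\<close>, so \<open>z\<close> is real.\<close>

lemma complex_eigenvalue_of_real_symmetric:
  fixes A :: "real mat"
  assumes A: "A \<in> carrier_mat n n" and sym: "A\<^sup>T = A"
    and ev: "eigenvalue (map_mat complex_of_real A) z"
  obtains x where "z = of_real x" "eigenvalue A x"
proof -
  let ?C = "map_mat complex_of_real A"
  have C: "?C \<in> carrier_mat n n" using A by simp
  from ev obtain v where v: "v \<in> carrier_vec n" "v \<noteq> 0\<^sub>v n" "?C *\<^sub>v v = z \<cdot>\<^sub>v v"
    using C unfolding eigenvalue_def eigenvector_def by auto
  have symA: "A $$ (i, j) = A $$ (j, i)" if "i < n" "j < n" for i j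
    using that A arg_cong[OF sym, of "\<lambda>M. M $$ (i, j)"] by simp
  have row: "(\<Sum>j<n. of_real (A $$ (i, j)) * v $ j) = z * v $ i" if i: "i < n" for i
    using arg_cong[OF v(3), of "\<lambda>w. w $ i"] i A v(1)
    by (simp add: scalar_prod_def lessThan_atLeast0)
  define S where "S = (\<Sum>i<n. (cmod (v $ i))\<^sup>2)"
  define T where "T = (\<Sum>i<n. \<Sum>j<n. cnj (v $ i) * of_real (A $$ (i, j)) * v $ j)"
  have "T = (\<Sum>i<n. cnj (v $ i) * (\<Sum>j<n. of_real (A $$ (i, j)) * v $ j))"
    unfolding T_def by (simp add: sum_distrib_left mult.assoc)
  also have "\<dots> = (\<Sum>i<n. z * of_real ((cmod (v $ i))\<^sup>2))"
    by (intro sum.cong refl) (simp add: row complex_norm_square del: of_real_power)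
  finally have T: "T = z * of_real S"
    unfolding S_def by (simp add: sum_distrib_left)
  have "cnj T = (\<Sum>i<n. \<Sum>j<n. v $ i * of_real (A $$ (i, j)) * cnj (v $ j))"
    unfolding T_def by simp
  also have "\<dots> = (\<Sum>j<n. \<Sum>i<n. v $ i * of_real (A $$ (i, j)) * cnj (v $ j))"
    by (rule sum.swap)
  also have "\<dots> = T"
    unfolding T_def by (intro sum.cong refl) (simp add: symA mult_ac)
  finally have "cnj T = T" .
  moreover obtain i where "i < n" "v $ i \<noteq> 0" using v(1,2) by (metis carrier_vecD eq_vecI index_zero_vec)
  then have "S > 0" unfolding S_def by (intro sum_pos2[of _ i]) auto
  ultimately have "cnj z = z" unfolding T by simp
  then have z: "z = of_real (Re z)" by (simp add: complex_eq_iff)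
  \<comment> \<open>The characteristic polynomial, common to the real and the complex matrix, turns
    the real number into an eigenvalue of \<open>A\<close> without a real eigenvector being
    built.\<close>
  have "poly (map_poly complex_of_real (char_poly A)) (of_real (Re z)) = 0"
    using ev z eigenvalue_root_char_poly[OF C] of_real_hom.char_poly_hom[OF A, where ?'a = complex] by simp
  then have "eigenvalue A (Re z)"
    unfolding eigenvalue_root_char_poly[OF A] of_real_hom.poly_map_poly by simp
  with z that show thesis by blast
qed

section \<open>Powers of symmetric matrices, and symmetric matrices with no eigenvalue but 0\<close>

lemma pow_mat_add:
  assumes A: "A \<in> carrier_mat n n"
  shows "A ^\<^sub>m (k + l) = A ^\<^sub>m k * A ^\<^sub>m l"
proof (induction l)
  case 0
  show ?case using A by (simp add: pow_mat_dim)
next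
  case (Suc l)
  then show ?case using A by (simp add: assoc_mult_mat[of _ n n _ n _ n])
qed

lemma transpose_pow_mat_sym:
  assumes A: "(A :: 'a :: comm_semiring_1 mat) \<in> carrier_mat n n" and sym: "A\<^sup>T = A"
  shows "(A ^\<^sub>m k)\<^sup>T = A ^\<^sub>m k"
proof (induction k)
  case 0
  show ?case using A by simp
next
  case (Suc k)
  have "(A ^\<^sub>m Suc k)\<^sup>T = A * A ^\<^sub>m k"
    using A Suc sym by (simp add: transpose_mult[of _ n n])
  also have "\<dots> = A ^\<^sub>m Suc k"
    using pow_mat_add[OF A, of 1 k] pow_mat_add[OF A, of k 1] A by simp
  finally show ?case .
qed

lemma symmetric_mat_square_diag:
  fixes A :: "real mat"
  assumes A: "A \<in> carrier_mat n n" and sym: "A\<^sup>T = A" and i: "i < n"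
  shows "(A * A) $$ (i, i) = (\<Sum>j<n. (A $$ (i, j))\<^sup>2)"
proof -
  have "A $$ (j, i) = A $$ (i, j)" if "j < n" for j
    using that i A arg_cong[OF sym, of "\<lambda>M. M $$ (i, j)"] by simp
  then show ?thesis
    using A i by (simp add: scalar_prod_def power2_eq_square lessThan_atLeast0)
qed

text \<open>The square of a nonzero symmetric matrix has a positive diagonal entry, which grows under
  repeated squaring after scaling; a spectral radius of 0 would keep the powers bounded.\<close>

lemma symmetric_mat_eq_zeroI:
  fixes B :: "real mat"
  assumes B: "B \<in> carrier_mat n n" and sym: "B\<^sup>T = B"
    and ev: "\<And>z. eigenvalue (map_mat complex_of_real B) z \<Longrightarrow> z = 0"
  shows "B = 0\<^sub>m n n"
proof (rule ccontr)
  assume "B \<noteq> 0\<^sub>m n n"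
  then obtain i j where ij: "i < n" "j < n" "B $$ (i, j) \<noteq> 0"
    using B by (metis carrier_matD eq_matI index_zero_mat)
  define s where "s = (B * B) $$ (i, i)"
  have s: "s > 0"
    unfolding s_def symmetric_mat_square_diag[OF B sym ij(1)]
    using ij by (intro sum_pos2[of _ j]) auto
  \<comment> \<open>Scaling keeps 0 as the only possible eigenvalue and raises the diagonal entry of
    the square to \<open>c * (c * s)\<close>, at least 2.\<close>
  define c where "c = 1 + 2 / s"
  have c: "c \<ge> 1" "c * s \<ge> 2" using s by (auto simp: c_def field_simps)
  define C where "C = c \<cdot>\<^sub>m B"
  have C: "C \<in> carrier_mat n n" using B by (simp add: C_def)
  have symC: "C\<^sup>T = C"
  proof (rule eq_matI)
    fix k l assume kl: "k < dim_row C" "l < dim_col C"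
    have "B $$ (l, k) = B $$ (k, l)"
      using kl C B arg_cong[OF sym, of "\<lambda>M. M $$ (k, l)"] by simp
    then show "C\<^sup>T $$ (k, l) = C $$ (k, l)" using kl B C unfolding C_def by simp
  qed (use C in auto)
  let ?C = "map_mat complex_of_real C"
  have CC: "?C \<in> carrier_mat n n" using C by simp
  have "spectrum ?C \<subseteq> {0}"
  proof
    fix z assume "z \<in> spectrum ?C"
    then obtain v where v: "v \<in> carrier_vec n" "v \<noteq> 0\<^sub>v n" "?C *\<^sub>v v = z \<cdot>\<^sub>v v"
      using CC unfolding spectrum_def eigenvalue_def eigenvector_def by auto
    have "map_mat complex_of_real B *\<^sub>v v = (z / of_real c) \<cdot>\<^sub>v v"
    proof (rule eq_vecI)
      fix k assume "k < dim_vec ((z / of_real c) \<cdot>\<^sub>v v)"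
      then have k: "k < n" using v by simp
      have "of_real c * (map_mat complex_of_real B *\<^sub>v v) $ k = (?C *\<^sub>v v) $ k"
        using k B v(1) by (simp add: C_def scalar_prod_def sum_distrib_left mult.assoc)
      also have "\<dots> = z * v $ k" using v k by simp
      finally show "(map_mat complex_of_real B *\<^sub>v v) $ k = ((z / of_real c) \<cdot>\<^sub>v v) $ k"
        using k v(1) c(1) by (simp add: field_simps)
    qed (use B v in auto)
    then have "eigenvalue (map_mat complex_of_real B) (z / of_real c)"
      using v B unfolding eigenvalue_def eigenvector_def by auto
    from ev[OF this] show "z \<in> {0}" using c by auto
  qed
  then have "spectral_radius ?C < 1"
    using spectral_radius_mem_max(1)[OF CC] ij(1) by auto
  \<comment> \<open>A spectral radius below 1 bounds the entries of all powers by one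
    constant.\<close>
  from spectral_radius_jnf_norm_bound_less_1_upper_triangular[OF CC this]
  obtain b where b: "\<And>k. norm_bound (?C ^\<^sub>m k) b" by blast
  have bound: "\<bar>(C ^\<^sub>m k) $$ (i, i)\<bar> \<le> b" for k
  proof -
    have "?C ^\<^sub>m k = map_mat complex_of_real (C ^\<^sub>m k)"
      using of_real_hom.mat_hom_pow[OF C] by metis
    moreover have "C ^\<^sub>m k \<in> carrier_mat n n" using C by simp
    ultimately have "norm (complex_of_real ((C ^\<^sub>m k) $$ (i, i))) \<le> b"
      using b[of k, unfolded norm_bound_def, rule_format, of i i] ij(1)
      by (simp only: index_map_mat carrier_matD)
    then show ?thesis by simp
  qed
  \<comment> \<open>Powers of \<open>C\<close> are symmetric, so squaring one replaces a diagonal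
    entry by a row sum of squares, which is at least the square of that entry.\<close>
  have growth: "(C ^\<^sub>m (2 ^ Suc k)) $$ (i, i) \<ge> 2 ^ Suc k" for k
  proof (induction k)
    case 0
    have "(C ^\<^sub>m 2) $$ (i, i) = c * (c * s)"
      using B ij(1)  unfolding C_def s_def
      by (simp add: numeral_2_eq_2 scalar_prod_def sum_distrib_left mult_ac)
    also have "\<dots> \<ge> 1 * 2" using c by (intro mult_mono) auto
    finally show ?case by simp
  next
    case (Suc k)
    let ?M = "C ^\<^sub>m (2 ^ Suc k)"
    have M: "?M \<in> carrier_mat n n" using C by simp
    have "C ^\<^sub>m (2 ^ Suc (Suc k)) = ?M * ?M"
      using pow_mat_add[OF C, of "2 ^ Suc k" "2 ^ Suc k"] by (simp add: mult_2)
    then have "(C ^\<^sub>m (2 ^ Suc (Suc k))) $$ (i, i) = (\<Sum>j<n. (?M $$ (i, j))\<^sup>2)"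
      using symmetric_mat_square_diag[OF M transpose_pow_mat_sym[OF C symC] ij(1)] by simp
    moreover have "(?M $$ (i, i))\<^sup>2 \<le> (\<Sum>j<n. (?M $$ (i, j))\<^sup>2)"
      using ij(1) by (intro member_le_sum) auto
    moreover have "(2 ^ Suc k)\<^sup>2 \<le> (?M $$ (i, i))\<^sup>2"
      using Suc by (intro power_mono) auto
    moreover have "(2 :: real) ^ Suc (Suc k) \<le> (2 ^ Suc k)\<^sup>2"
      unfolding power_mult[symmetric] by (intro power_increasing) auto
    ultimately show ?case by linarith
  qed
  obtain k where "b < 2 ^ k" using real_arch_pow[of 2 b] by auto
  also have "(2::real) ^ k \<le> 2 ^ Suc k" by simp
  finally show False using growth[of k] bound[of "2 ^ Suc k"] by linarith
qed

text \<open>The matrix \<open>B\<close> is (A - a)(A - b). For an eigenvalue \<open>z\<close> of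
  \<open>B\<close>, the polynomial (x - a)(x - b) - z splits over the complex numbers as (x - s)(x -
  t), so (A - s)(A - t) is singular and \<open>s\<close> or \<open>t\<close> is an eigenvalue of
  \<open>A\<close>, that is, \<open>a\<close> or \<open>b\<close>. Hence \<open>z = 0\<close>, and
  the symmetric matrix \<open>B\<close> vanishes.\<close>

lemma symmetric_two_eigenvalues:
  fixes A :: "real mat"
  assumes A: "A \<in> carrier_mat n n" and sym: "A\<^sup>T = A"
    and ab: "\<And>x. eigenvalue A x \<Longrightarrow> x = a \<or> x = b"
  shows "A * A = (a + b) \<cdot>\<^sub>m A - (a * b) \<cdot>\<^sub>m 1\<^sub>m n"
proof -
  define B where "B = A * A - ((a + b) \<cdot>\<^sub>m A - (a * b) \<cdot>\<^sub>m 1\<^sub>m n)"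
  have B: "B \<in> carrier_mat n n" using A unfolding B_def carrier_mat_def by simp
  have symA: "A $$ (i, j) = A $$ (j, i)" if "i < n" "j < n" for i j
    using that A arg_cong[OF sym, of "\<lambda>M. M $$ (i, j)"] by simp
  have entry: "B $$ (i, j) = (\<Sum>k<n. A $$ (i, k) * A $$ (k, j)) - (a + b) * A $$ (i, j) + (if i = j then a * b else 0)"
    if "i < n" "j < n" for i j
    using that A unfolding B_def by (simp add: scalar_prod_def lessThan_atLeast0)
  have "B\<^sup>T = B"
  proof (rule eq_matI)
    fix i j assume "i < dim_row B" "j < dim_col B"
    then have ij: "i < n" "j < n" using B by auto
    have "(\<Sum>k<n. A $$ (i, k) * A $$ (k, j)) = (\<Sum>k<n. A $$ (j, k) * A $$ (k, i))"
      using ij by (intro sum.cong refl) (simp add: symA mult.commute)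
    then show "B\<^sup>T $$ (i, j) = B $$ (i, j)" using ij B by (auto simp: entry symA)
  qed (use B in auto)
  moreover have "z = 0" if "eigenvalue (map_mat complex_of_real B) z" for z
  proof -
    let ?A = "map_mat complex_of_real A" and ?B = "map_mat complex_of_real B"
    have CA: "?A \<in> carrier_mat n n" and CB: "?B \<in> carrier_mat n n" using A B by auto
    \<comment> \<open>The discriminant of x^2 - (a + b) x + (a b - z), whose roots are
      \<open>s\<close> and \<open>t\<close>.\<close>
    define D where "D = (of_real (a + b))\<^sup>2 - 4 * (of_real (a * b) - z)"
    define s where "s = (of_real (a + b) + csqrt D) / 2"
    define t where "t = (of_real (a + b) - csqrt D) / 2"
    have st: "s + t = of_real (a + b)" by (simp add: s_def t_def field_simps)
    have "s * t = ((of_real (a + b))\<^sup>2 - (csqrt D)\<^sup>2) / 4"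
      by (simp add: s_def t_def power2_eq_square algebra_simps)
    then have "4 * z = 4 * (of_real (a * b) - s * t)" by (simp add: D_def algebra_simps)
    then have st': "z = of_real (a * b) - s * t" by (simp only: mult_cancel_left) simp
    have root: "u = of_real a \<or> u = of_real b" if "eigenvalue ?A u" for u
      using complex_eigenvalue_of_real_symmetric[OF A sym that] ab by metis
    have "char_matrix ?B z = char_matrix ?A s * char_matrix ?A t"
    proof (rule eq_matI)
      fix i j assume "i < dim_row (char_matrix ?A s * char_matrix ?A t)"
        "j < dim_col (char_matrix ?A s * char_matrix ?A t)"
      then have ij: "i < n" "j < n" using A by (auto simp: char_matrix_def)
      have "(char_matrix ?A s * char_matrix ?A t) $$ (i, j) =
        (\<Sum>k<n. (of_real (A $$ (i, k)) - (if i = k then s else 0)) *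
              (of_real (A $$ (k, j)) - (if k = j then t else 0)))"
        using ij A unfolding char_matrix_def
        by (auto simp: scalar_prod_def lessThan_atLeast0 intro!: sum.cong)
      also have "\<dots> = (\<Sum>k<n. of_real (A $$ (i, k) * A $$ (k, j))
          - (if k = j then of_real (A $$ (i, k)) * t else 0)
          - (if i = k then s * of_real (A $$ (k, j)) else 0)
          + (if k = i then (if k = j then s * t else 0) else 0))"
        by (intro sum.cong refl) (auto simp: algebra_simps)
      also have "\<dots> = (\<Sum>k<n. of_real (A $$ (i, k) * A $$ (k, j)))
          - of_real (A $$ (i, j)) * t - s * of_real (A $$ (i, j)) + (if i = j then s * t else 0)"
        using ij by (simp add: sum.distrib sum_subtractf)
      also have "\<dots> = (\<Sum>k<n. of_real (A $$ (i, k) * A $$ (k, j)))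
          - (s + t) * of_real (A $$ (i, j)) + (if i = j then s * t else 0)"
        by (simp add: algebra_simps)
      also have "\<dots> = char_matrix ?B z $$ (i, j)"
        using ij B unfolding char_matrix_def st by (auto simp: entry st')
      finally show "char_matrix ?B z $$ (i, j) = (char_matrix ?A s * char_matrix ?A t) $$ (i, j)"
        by simp
    qed (use A B in \<open>auto simp: char_matrix_def\<close>)
    moreover have "det (char_matrix ?B z) = 0"
      using that eigenvalue_det[OF CB] by simp
    ultimately have "det (char_matrix ?A s) * det (char_matrix ?A t) = 0"
      using det_mult[OF char_matrix_closed[OF CA] char_matrix_closed[OF CA]] by metis
    then have "eigenvalue ?A s \<or> eigenvalue ?A t"
      using eigenvalue_det[OF CA] by auto
    then consider "s = of_real a" | "s = of_real b" | "t = of_real a" | "t = of_real b"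
      using root by blast
    then show ?thesis
    proof cases
      case 1 then have "t = of_real b" using st by simp
      with 1 show ?thesis using st' by simp
    next
      case 2 then have "t = of_real a" using st by simp
      with 2 show ?thesis using st' by simp
    next
      case 3 then have "s = of_real b" using st by simp
      with 3 show ?thesis using st' by simp
    next
      case 4 then have "s = of_real a" using st by simp
      with 4 show ?thesis using st' by simp
    qed
  qed
  ultimately have "B = 0\<^sub>m n n" using symmetric_mat_eq_zeroI[OF B] by blast
  then have "B $$ (i, j) = 0" if "i < n" "j < n" for i j using that by simp
  then show ?thesis
    using A by (intro eq_matI) (auto simp: B_def)
qed

section \<open>Distance levels\<close>

definition preds :: "('a \<Rightarrow> 'a \<Rightarrow> bool) \<Rightarrow> ('a \<Rightarrow> nat) \<Rightarrow> 'a \<Rightarrow> 'a set" where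
  "preds adj L w = {u. adj u w \<and> Suc (L u) = L w}"

definition flat_edges :: "('a \<Rightarrow> 'a \<Rightarrow> bool) \<Rightarrow> ('a \<Rightarrow> nat) \<Rightarrow> 'a set set" where
  "flat_edges adj L = {{u, w} |u w. adj u w \<and> L u = L w}"

text \<open>Excess 0. The level function is a parameter because the levels seen from two different
  roots are compared later.\<close>

definition exact_levels :: "'a set \<Rightarrow> ('a \<Rightarrow> 'a \<Rightarrow> bool) \<Rightarrow> ('a \<Rightarrow> nat) \<Rightarrow> bool" where
  "exact_levels V adj L \<longleftrightarrow> (\<forall>u w. adj u w \<longrightarrow> L u \<noteq> L w) \<and>
     (\<forall>w\<in>V. 2 \<le> L w \<longrightarrow> card (preds adj L w) = 2)"

text \<open>In assumption \<open>parallel\<close>, the rows of \<open>x\<close> and \<open>y\<close> restricted to \<open>{a, b}\<close> are both orthogonal to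
  the row of \<open>p\<close>, hence not orthogonal to each other.\<close>

locale quad_graph =
  fixes V :: "'a set" and adj :: "'a \<Rightarrow> 'a \<Rightarrow> bool"
  assumes finite_V: "finite V"
    and adj_V: "adj u w \<Longrightarrow> u \<in> V"
    and adj_sym: "adj u w \<Longrightarrow> adj w u"
    and adj_irrefl: "\<not> adj u u"
    and quad: "adj u x \<Longrightarrow> adj x w \<Longrightarrow> u \<noteq> w \<Longrightarrow> \<not> adj u w \<Longrightarrow> \<exists>y. y \<noteq> x \<and> adj u y \<and> adj y w"
    and parallel: "{u. adj p u \<and> adj u x} = {a, b} \<Longrightarrow> {u. adj p u \<and> adj u y} = {a, b} \<Longrightarrow> a \<noteq> b \<Longrightarrow>
      p \<noteq> x \<Longrightarrow> p \<noteq> y \<Longrightarrow> x \<noteq> y \<Longrightarrow> \<not> adj p x \<Longrightarrow> \<not> adj p y \<Longrightarrow> \<not> adj x y \<Longrightarrow>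
      \<exists>w. w \<noteq> a \<and> w \<noteq> b \<and> adj x w \<and> adj w y"
begin

section \<open>Edges and degrees\<close>

lemma adj_V2: "adj u w \<Longrightarrow> w \<in> V"
  using adj_V adj_sym by blast

definition edges :: "'a set set" where
  "edges = {{u, w} |u w. adj u w}"

lemma finite_edges: "finite edges"
  by (rule finite_subset[of _ "Pow V"]) (auto simp: edges_def finite_V dest: adj_V adj_V2)

lemma edge_iff: "{u, w} \<in> edges \<longleftrightarrow> adj u w"
  unfolding edges_def by (auto simp: doubleton_eq_iff dest: adj_sym)

text \<open>Double counting of incidences; it serves to find a vertex of degree 3 when no vertex has
  degree 2.\<close>

lemma handshake: "(\<Sum>w\<in>V. card {u. adj w u}) = 2 * card edges"
proof -
  have "(\<Sum>w\<in>V. card {e \<in> edges. w \<in> e}) = 2 * card edges"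
  proof (rule sum_multicount[OF finite_V finite_edges], rule ballI)
    fix e assume "e \<in> edges"
    then obtain u w where e: "e = {u, w}" "adj u w" unfolding edges_def by blast
    then have "{i \<in> V. i \<in> e} = {u, w}" "u \<noteq> w"
      using adj_V adj_V2 adj_irrefl by auto
    then show "card {i \<in> V. i \<in> e} = 2" by simp
  qed
  moreover have "card {e \<in> edges. w \<in> e} = card {u. adj w u}" for w
  proof -
    have "{e \<in> edges. w \<in> e} = (\<lambda>u. {w, u}) ` {u. adj w u}"
      unfolding edges_def by (auto dest: adj_sym)
    moreover have "inj_on (\<lambda>u. {w, u}) {u. adj w u}"
      by (auto simp: inj_on_def doubleton_eq_iff)
    ultimately show ?thesis by (simp add: card_image)
  qed
  ultimately show ?thesis by simp
qed

end

text \<open>Characterises \<open>L\<close> as the distance from \<open>r\<close>. As a locale it can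
  be interpreted for a second root inside a proof about the first.\<close>

locale leveled = quad_graph +
  fixes r :: 'a and L :: "'a \<Rightarrow> nat"
  assumes root_V: "r \<in> V"
    and L_zero: "u \<in> V \<Longrightarrow> L u = 0 \<longleftrightarrow> u = r"
    and L_step: "adj u w \<Longrightarrow> L w \<le> Suc (L u)"
    and L_pred: "u \<in> V \<Longrightarrow> L u = Suc i \<Longrightarrow> \<exists>w. adj w u \<and> L w = i"
begin

abbreviation N :: "nat \<Rightarrow> 'a set" where "N i \<equiv> {u \<in> V. L u = i}"
abbreviation pre :: "'a \<Rightarrow> 'a set" where "pre \<equiv> preds adj L"

lemma finite_N: "finite (N i)" using finite_V by simp

lemma pre_sub: "pre w \<subseteq> V" by (auto simp: preds_def dest: adj_V)

lemma finite_pre: "finite (pre w)" using finite_subset[OF pre_sub finite_V] .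

lemma in_pre: "u \<in> pre w \<longleftrightarrow> adj u w \<and> Suc (L u) = L w"
  by (simp add: preds_def)

lemma pre_N: "w \<in> N (Suc i) \<Longrightarrow> pre w \<subseteq> N i"
  by (auto simp: preds_def dest: adj_V)

lemma adj_level: "adj u w \<Longrightarrow> L u = L w \<or> u \<in> pre w \<or> w \<in> pre u"
  using L_step[of u w] L_step[of w u] adj_sym[of u w] unfolding in_pre by auto

lemma N_zero: "N 0 = {r}" using L_zero root_V by auto

lemma pre_root: "pre r = {}"
  using L_zero[OF root_V] by (auto simp: preds_def)

lemma pre_one: assumes "w \<in> N 1" shows "pre w = {r}"
proof -
  have "pre w \<subseteq> {r}" using pre_N[of w 0] assms N_zero by simp
  moreover have "pre w \<noteq> {}" using L_pred[of w 0] assms by (auto simp: preds_def)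
  ultimately show ?thesis by blast
qed

lemma N_one: "N 1 = {u. adj r u}"
proof (rule equalityI; rule subsetI)
  fix u assume "u \<in> N 1"
  then show "u \<in> {u. adj r u}" using pre_one[of u] by (auto simp: preds_def)
next
  fix u assume "u \<in> {u. adj r u}"
  then have "adj r u" "u \<in> V" "u \<noteq> r" using adj_V2 adj_irrefl by auto
  then show "u \<in> N 1" using L_step[of r u] L_zero[of u] L_zero[OF root_V] by auto
qed

text \<open>Vertices two levels apart are distinct and nonadjacent, so \<open>quad\<close> yields a
  second middle vertex, and \<open>L_step\<close> from both sides fixes its level.\<close>

lemma two_step:
  assumes "adj u y" "adj y s" "L s = L u + 2"
  obtains y' where "y' \<noteq> y" "adj u y'" "adj y' s" "L y' = Suc (L u)"
proof -
  have "u \<noteq> s" "\<not> adj u s" using assms(3) L_step[of u s] by auto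
  from quad[OF assms(1,2) this] obtain y' where y': "y' \<noteq> y" "adj u y'" "adj y' s" by blast
  have "L y' = Suc (L u)" using L_step[OF y'(2)] L_step[OF y'(3)] assms(3) by simp
  with y' that show thesis by blast
qed

text \<open>A descending path of two steps from \<open>w\<close> has a second middle vertex by
  \<open>two_step\<close>.\<close>

lemma pre_ge_two: assumes "w \<in> V" "2 \<le> L w" shows "2 \<le> card (pre w)"
proof -
  obtain y where y: "adj y w" "Suc (L y) = L w"
    using L_pred[OF assms(1), of "L w - 1"] assms(2) by auto
  obtain u where u: "adj u y" "Suc (L u) = L y"
    using L_pred[OF adj_V[OF y(1)], of "L y - 1"] y(2) assms(2) by auto
  obtain y' where "y' \<noteq> y" "adj y' w" "L y' = Suc (L u)"
    using two_step[OF u(1) y(1)] y(2) u(2) by auto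
  then have "{y, y'} \<subseteq> pre w" "card {y, y'} = 2" using y u by (auto simp: in_pre)
  then show ?thesis using card_mono[OF finite_pre] by metis
qed

section \<open>Counting edges by levels\<close>

lemma card_edges_levels: "card edges = (\<Sum>w\<in>V. card (pre w)) + card (flat_edges adj L)"
proof -
  \<comment> \<open>An edge between different levels is encoded once, as its upper end paired with
    its lower end.\<close>
  let ?S = "Sigma V pre" and ?f = "\<lambda>(w, u). {u, w}"
  have inj: "inj_on ?f ?S"
    by (auto simp: inj_on_def doubleton_eq_iff in_pre)
  have union: "edges = ?f ` ?S \<union> flat_edges adj L"
  proof
    show "edges \<subseteq> ?f ` ?S \<union> flat_edges adj L"
    proof
      fix e assume "e \<in> edges"
      then obtain u w where e: "e = {u, w}" "adj u w" unfolding edges_def by blast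
      consider "L u = L w" | "u \<in> pre w" | "w \<in> pre u" using adj_level[OF e(2)] by blast
      then show "e \<in> ?f ` ?S \<union> flat_edges adj L"
      proof cases
        case 1 then show ?thesis using e unfolding flat_edges_def by blast
      next
        case 2
        then have "(w, u) \<in> ?S" using adj_V2[OF e(2)] by simp
        from imageI[OF this, of ?f] show ?thesis using e by simp
      next
        case 3
        then have "(u, w) \<in> ?S" using adj_V[OF e(2)] by simp
        from imageI[OF this, of ?f] show ?thesis using e by (simp add: insert_commute)
      qed
    qed
    show "?f ` ?S \<union> flat_edges adj L \<subseteq> edges"
      by (auto simp: in_pre edge_iff flat_edges_def)
  qed
  have disj: "?f ` ?S \<inter> flat_edges adj L = {}"
    unfolding flat_edges_def by (auto simp: in_pre doubleton_eq_iff)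
  have "card (?f ` ?S) = (\<Sum>w\<in>V. card (pre w))"
    using card_image[OF inj] finite_V finite_pre by simp
  moreover have "finite (?f ` ?S)" "finite (flat_edges adj L)"
    using finite_edges union by (metis finite_Un)+
  ultimately show ?thesis using card_Un_disjoint disj union by metis
qed

text \<open>With d vertices in level 1, the root contributes no predecessor, level 1 contributes d,
  and each of the n - 1 - d others contributes 2 plus its surplus. The truncated subtraction is
  exact by \<open>pre_ge_two\<close>.\<close>

lemma edge_excess:
  assumes "card edges + 4 = 2 * card V"
  shows "(\<Sum>w\<in>{w\<in>V. 2 \<le> L w}. card (pre w) - 2) + card (flat_edges adj L) + 2 = card (N 1)"
proof -
  let ?R = "{w\<in>V. 2 \<le> L w}"
  have V: "V = insert r (N 1 \<union> ?R)"
  proof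
    show "V \<subseteq> insert r (N 1 \<union> ?R)"
    proof
      fix u assume "u \<in> V"
      then show "u \<in> insert r (N 1 \<union> ?R)" using L_zero[of u] by (cases "L u = 0") auto
    qed
  qed (use root_V in auto)
  have r: "r \<notin> N 1 \<union> ?R" using L_zero[OF root_V] by auto
  have disj: "N 1 \<inter> ?R = {}" by auto
  have fin: "finite (N 1)" "finite ?R" using finite_V by auto
  have "card V = Suc (card (N 1 \<union> ?R))"
    using card_insert_disjoint[OF _ r] fin V by (metis finite_Un)
  then have cV: "card V = Suc (card (N 1) + card ?R)"
    using card_Un_disjoint[OF fin disj] by simp
  have "(\<Sum>w\<in>V. card (pre w)) = card (pre r) + (\<Sum>w\<in>N 1 \<union> ?R. card (pre w))"
    using sum.insert[OF _ r, of "\<lambda>w. card (pre w)"] fin V by (metis finite_Un)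
  also have "\<dots> = (\<Sum>w\<in>N 1. card (pre w)) + (\<Sum>w\<in>?R. card (pre w))"
    using sum.union_disjoint[OF fin disj] by (simp add: pre_root)
  also have "(\<Sum>w\<in>N 1. card (pre w)) = (\<Sum>w\<in>N 1. 1)"
    by (intro sum.cong refl) (simp add: pre_one[simplified])
  also have "(\<Sum>w\<in>?R. card (pre w)) = (\<Sum>w\<in>?R. (card (pre w) - 2) + 2)"
  proof (rule sum.cong)
    fix w assume "w \<in> ?R"
    then show "card (pre w) = card (pre w) - 2 + 2" using pre_ge_two[of w] by simp
  qed simp
  finally have "(\<Sum>w\<in>V. card (pre w)) = card (N 1) + ((\<Sum>w\<in>?R. card (pre w) - 2) + 2 * card ?R)"
    by (simp only: sum.distrib sum_constant) simp
  then show ?thesis using assms card_edges_levels cV by simp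
qed

lemma flat_empty_iff: "card (flat_edges adj L) = 0 \<longleftrightarrow> (\<forall>u w. adj u w \<longrightarrow> L u \<noteq> L w)"
proof -
  have "finite (flat_edges adj L)"
    by (rule finite_subset[OF _ finite_edges]) (auto simp: flat_edges_def edges_def)
  then show ?thesis by (auto simp: flat_edges_def)
qed

lemma exact_if_degree_two:
  assumes "card edges + 4 = 2 * card V" and "card (N 1) = 2"
  shows "exact_levels V adj L"
proof -
  from edge_excess[OF assms(1)] assms(2)
  have "(\<Sum>w\<in>{w\<in>V. 2 \<le> L w}. card (pre w) - 2) = 0" and f: "card (flat_edges adj L) = 0"
    by auto
  then have "card (pre w) \<le> 2" if "w \<in> V" "2 \<le> L w" for w
    using that finite_V by auto
  then have "card (pre w) = 2" if "w \<in> V" "2 \<le> L w" for w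
    using that pre_ge_two[OF that] by (simp add: le_antisym)
  then show ?thesis using f flat_empty_iff unfolding exact_levels_def by blast
qed

text \<open>A level consisting of two vertices with a common successor forces the level below to have
  two vertices as well; descending, the root has degree 2.\<close>

lemma collapse:
  assumes "1 \<le> i" and "card (N i) = 2" and "s \<in> N (Suc i)" and "N i \<subseteq> pre s"
    and two: "\<And>w. w \<in> V \<Longrightarrow> 2 \<le> L w \<Longrightarrow> L w \<le> i \<Longrightarrow> card (pre w) = 2"
    and succ: "\<And>u. u \<in> V \<Longrightarrow> 1 \<le> L u \<Longrightarrow> L u < i \<Longrightarrow> \<exists>w. adj u w \<and> L w = Suc (L u)"
  shows "card (N 1) = 2"
  using assms
proof (induction i arbitrary: s rule: nat_induct_at_least)
  case base
  then show ?case by simp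
next
  case (Suc j)
  obtain p where p: "p \<in> N (Suc j)" using Suc.prems(1) by (metis card.empty equals0I zero_neq_numeral)
  \<comment> \<open>A vertex \<open>u\<close> of level \<open>j\<close> has a successor
    \<open>p'\<close>, and \<open>two_step\<close> along the path from \<open>u\<close> through
    \<open>p'\<close> to \<open>s\<close> gives another. Level \<open>j + 1\<close> has only two
    vertices, so \<open>u\<close> is adjacent to both. Thus \<open>p\<close> takes over the role of
    \<open>s\<close> one level lower.\<close>
  have "N j \<subseteq> pre p"
  proof
    fix u assume u: "u \<in> N j"
    then obtain p' where p': "adj u p'" "L p' = Suc j" using Suc.prems(5)[of u] Suc.hyps by auto
    then have p'N: "p' \<in> N (Suc j)" using adj_V2 by auto
    then have "adj p' s" using Suc.prems(3) in_pre by blast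
    then obtain y where y: "y \<noteq> p'" "adj u y" "L y = Suc (L u)"
      using two_step[OF p'(1)] Suc.prems(2) u by auto
    then have yN: "y \<in> N (Suc j)" using u adj_V2 by auto
    have "{y, p'} = N (Suc j)"
      using Suc.prems(1) p'N yN y(1) by (intro card_seteq[OF finite_N]) auto
    then have "p = y \<or> p = p'" using p by blast
    then show "u \<in> pre p" using y p' u by (auto simp: in_pre)
  qed
  then have "N j = pre p" using pre_N[OF p] by blast
  moreover have "card (pre p) = 2" using Suc.prems(4)[of p] p Suc.hyps by simp
  ultimately have "card (N j) = 2" by simp
  then show ?case
    using Suc.IH[of p] p \<open>N j \<subseteq> pre p\<close> Suc.prems(4,5) by auto
qed

lemma top_level:
  obtains h where "N h \<noteq> {}" "\<And>u. u \<in> V \<Longrightarrow> L u \<le> h"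
proof -
  have fin: "finite (L ` V)" and ne: "L ` V \<noteq> {}" using finite_V root_V by auto
  have "Max (L ` V) \<in> L ` V" using Max_in[OF fin ne] .
  then have "N (Max (L ` V)) \<noteq> {}" by fastforce
  with that show thesis using Max_ge[OF fin] by blast
qed

lemma nbrs_split: "{u. adj w u} = pre w \<union> {u. adj w u \<and> L u = L w} \<union> {u. adj w u \<and> L u = Suc (L w)}"
proof (rule Set.set_eqI)
  fix u
  show "u \<in> {u. adj w u} \<longleftrightarrow>
      u \<in> pre w \<union> {u. adj w u \<and> L u = L w} \<union> {u. adj w u \<and> L u = Suc (L w)}"
    using adj_level[of w u] adj_sym[of w u] adj_sym[of u w] by (auto simp: in_pre)
qed

end

text \<open>The level is the least length of a walk from the root. A shortest walk extended by an
  edge gives \<open>L_step\<close>, and its last vertex but one gives \<open>L_pred\<close>.\<close>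

lemma (in quad_graph) exists_levels:
  assumes r: "r \<in> V" and conn: "\<And>u. u \<in> V \<Longrightarrow> (r, u) \<in> {(a, b). adj a b}\<^sup>*"
  shows "\<exists>L. leveled V adj r L"
proof -
  let ?R = "{(a, b). adj a b}"
  define L where "L u = (LEAST k. (r, u) \<in> ?R ^^ k)" for u
  have L: "(r, u) \<in> ?R ^^ L u" if "u \<in> V" for u
    using LeastI_ex[of "\<lambda>k. (r, u) \<in> ?R ^^ k"] conn[OF that] rtrancl_imp_relpow
    unfolding L_def by blast
  have le: "L u \<le> k" if "(r, u) \<in> ?R ^^ k" for u k
    unfolding L_def by (rule Least_le) (rule that)
  have "leveled V adj r L"
  proof (unfold_locales)
    show "r \<in> V" by (rule r)
    show "L u = 0 \<longleftrightarrow> u = r" if "u \<in> V" for u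
      using L[OF that] le[of r 0] by auto
    show step: "L w \<le> Suc (L u)" if "adj u w" for u w
      using le[OF relpow_Suc_I[OF L[OF adj_V[OF that]]]] that by blast
    show "\<exists>w. adj w u \<and> L w = i" if uV: "u \<in> V" and Lu: "L u = Suc i" for u i
    proof -
      obtain w where w: "(r, w) \<in> ?R ^^ i" "adj w u"
        using L[OF uV] Lu by (auto elim: relpow_Suc_E)
      with le[OF w(1)] step[OF w(2)] Lu show ?thesis by force
    qed
  qed
  then show ?thesis by blast
qed

section \<open>Candles\<close>

lemma card_2_eq_doubleton: "card A = 2 \<Longrightarrow> a \<in> A \<Longrightarrow> b \<in> A \<Longrightarrow> a \<noteq> b \<Longrightarrow> A = {a, b}"
  by (auto simp: card_2_iff)

context leveled
begin

lemma level_nonempty_below: "N k \<noteq> {} \<Longrightarrow> i \<le> k \<Longrightarrow> N i \<noteq> {}"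
proof (induction k)
  case 0
  then show ?case by simp
next
  case (Suc k)
  then obtain u where "u \<in> V" "L u = Suc k" by auto
  then obtain w where "adj w u" "L w = k" using L_pred by blast
  then have "N k \<noteq> {}" using adj_V by auto
  then show ?case using Suc by (cases "i = Suc k") auto
qed

text \<open>Every vertex of level \<open>i + 1\<close> has predecessors \<open>a\<close> and
  \<open>b\<close>, and any two of them share a successor. Seen from a vertex \<open>z\<close> of
  the last level, exactly two of them precede \<open>a\<close>; a third then lies beyond
  \<open>a\<close> and \<open>b\<close> and acquires a third predecessor.\<close>

lemma no_three_in_level:
  assumes exact: "exact_levels V adj L"
    and N: "N i = {a, b}" "a \<noteq> b"
    and p: "Suc (L p) = i" "adj p a" "adj p b"
    and ends: "\<And>z. z \<in> V \<Longrightarrow> card {u. adj z u} = 2 \<Longrightarrow> \<exists>M. leveled V adj z M \<and> exact_levels V adj M"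
  shows "card (N (Suc i)) \<le> 2"
proof (rule ccontr)
  assume "\<not> ?thesis"
  then have three: "card (N (Suc i)) \<ge> 3" by simp
  have noflat: "L u \<noteq> L w" if "adj u w" for u w
    using exact that unfolding exact_levels_def by blast
  have two: "card (pre w) = 2" if "w \<in> V" "2 \<le> L w" for w
    using exact that unfolding exact_levels_def by blast
  have ab: "L a = i" "L b = i" "a \<in> V" "b \<in> V" using N by auto
  have i: "1 \<le> i" using p(1) by simp
  have preX: "pre x = {a, b}" if "x \<in> N (Suc i)" for x
    using card_seteq[of "{a, b}" "pre x"] pre_N[OF that] two[of x] that i N by simp
  \<comment> \<open>\<open>parallel\<close> applies, since \<open>a\<close> and \<open>b\<close> are
    the only common neighbours of \<open>p\<close> with \<open>x\<close> and with \<open>y\<close>.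
    The new neighbour is no predecessor of \<open>x\<close> and no edge is flat, so it is a
    successor.\<close>
  have share: "\<exists>w. w \<noteq> a \<and> w \<noteq> b \<and> adj x w \<and> adj w y \<and> L w = Suc (Suc i)"
    if xy: "x \<in> N (Suc i)" "y \<in> N (Suc i)" "x \<noteq> y" for x y
  proof -
    have common: "{u. adj p u \<and> adj u x} = {a, b}" if x: "x \<in> N (Suc i)" for x
    proof (rule equalityI; rule subsetI)
      fix u assume "u \<in> {u. adj p u \<and> adj u x}"
      then have u: "adj p u" "adj u x" by auto
      then have "L u = i" using L_step[OF u(1)] L_step[OF u(2)] p(1) x by auto
      then show "u \<in> {a, b}" using adj_V[OF u(2)] N(1) by auto
    next
      fix u assume "u \<in> {a, b}"
      then show "u \<in> {u. adj p u \<and> adj u x}" using p preX[OF x] in_pre by auto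
    qed
    have far: "p \<noteq> x \<and> \<not> adj p x" if "x \<in> N (Suc i)" for x
      using L_step[of p x] p(1) that by auto
    have "\<not> adj x y" using noflat[of x y] xy by auto
    then obtain w where w: "w \<noteq> a" "w \<noteq> b" "adj x w" "adj w y"
      using parallel[OF common[OF xy(1)] common[OF xy(2)] N(2)] far xy by blast
    have "w \<notin> pre x" using preX[OF xy(1)] w by simp
    then have "x \<in> pre w" using adj_level[OF w(3)] noflat[OF w(3)] by blast
    then show ?thesis using w xy(1) in_pre by auto
  qed
  obtain z where z: "z \<in> V" and top: "\<And>u. u \<in> V \<Longrightarrow> L u \<le> L z"
    using top_level by auto
  have "\<not> card (N (Suc i)) \<le> Suc 0" using three by simp
  then obtain x y where xy: "x \<in> N (Suc i)" "y \<in> N (Suc i)" "x \<noteq> y"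
    using card_le_Suc0_iff_eq[OF finite_N] by blast
  from share[OF this] obtain w where w: "adj x w" "L w = Suc (Suc i)" by blast
  then have Lz: "L z \<ge> Suc (Suc i)" using top adj_V2 by metis
  \<comment> \<open>In the last level only predecessors are neighbours, so \<open>z\<close> has
    degree 2 and its own levels \<open>M\<close> are exact.\<close>
  have "{u. adj z u} = pre z"
  proof (rule equalityI; rule subsetI)
    fix u assume "u \<in> {u. adj z u}"
    then have u: "adj z u" by simp
    then show "u \<in> pre z"
      using adj_level[OF u] noflat[OF u] top[OF adj_V2[OF u]] by (auto simp: in_pre)
  qed (auto simp: in_pre adj_sym)
  then have "card {u. adj z u} = 2" using two[of z] z Lz by simp
  from ends[OF z this] obtain M where "leveled V adj z M" and exM: "exact_levels V adj M" by blast
  then interpret M: leveled V adj z M by simp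
  have noflatM: "M u \<noteq> M w" if "adj u w" for u w
    using exM that unfolding exact_levels_def by blast
  have twoM: "card (M.pre w) = 2" if "w \<in> V" "2 \<le> M w" for w
    using exM that unfolding exact_levels_def by blast
  define m where "m = Min (M ` N (Suc i))"
  have finM: "finite (M ` N (Suc i))" and neM: "M ` N (Suc i) \<noteq> {}" using finite_N xy by auto
  have "m \<in> M ` N (Suc i)" unfolding m_def using Min_in[OF finM neM] .
  then obtain x0 where x0: "x0 \<in> N (Suc i)" "M x0 = m" by auto
  have m_le: "m \<le> M x" if "x \<in> N (Suc i)" for x
    unfolding m_def using that finM by (intro Min_le) auto
  \<comment> \<open>a path from z into the levels up to i must cross level i + 1\<close>
  have below: "Suc m \<le> M u" if "u \<in> V" "L u \<le> i" for u
    using that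
  proof (induction "M u" arbitrary: u rule: less_induct)
    case less
    have "u \<noteq> z" using less.prems Lz by auto
    then obtain k where k: "M u = Suc k" using M.L_zero[OF less.prems(1)] by (cases "M u") auto
    obtain w where w: "adj w u" "M w = k" using M.L_pred[OF less.prems(1) k] by blast
    have Lw: "L w \<le> Suc i" using L_step[OF adj_sym[OF w(1)]] less.prems(2) by simp
    show ?case
    proof (cases "L w = Suc i")
      case True
      then show ?thesis using m_le[of w] adj_V[OF w(1)] w(2) k by simp
    next
      case False
      then have "Suc m \<le> M w" using less.hyps[of w] w k Lw adj_V[OF w(1)] by simp
      then show ?thesis using w k by simp
    qed
  qed
  have m: "m \<ge> 1" using M.L_zero[of x0] x0 Lz by (cases "m = 0") auto
  have Mab: "M u = Suc m" if "u \<in> {a, b}" for u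
  proof (rule antisym)
    have "adj u x0" using preX[OF x0(1)] that by (auto simp: in_pre)
    then show "M u \<le> Suc m" using M.L_step[OF adj_sym] x0(2) by metis
    show "Suc m \<le> M u" using below[of u] that ab by auto
  qed
  have preM: "M.pre a \<subseteq> {x \<in> N (Suc i). M x = m}"
  proof
    fix u assume "u \<in> M.pre a"
    then have u: "adj u a" "M u = m" using Mab by (auto simp: M.in_pre)
    then have "\<not> L u \<le> i" using below[of u] adj_V by auto
    then have "L u = Suc i" using L_step[OF adj_sym[OF u(1)]] ab by simp
    then show "u \<in> {x \<in> N (Suc i). M x = m}" using u adj_V by auto
  qed
  have "{x \<in> N (Suc i). M x = m} \<subseteq> M.pre a"
  proof
    fix x assume x: "x \<in> {x \<in> N (Suc i). M x = m}"
    then have "a \<in> pre x" using preX[of x] by simp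
    then have "adj x a" using in_pre adj_sym by blast
    then show "x \<in> M.pre a" using x Mab[of a] by (simp add: M.in_pre)
  qed
  with preM have eq: "{x \<in> N (Suc i). M x = m} = M.pre a" by blast
  \<comment> \<open>Only two vertices of level \<open>i + 1\<close> attain the minimum
    \<open>m\<close>, so some \<open>x3\<close> does not; being adjacent to \<open>a\<close>, it has
    \<open>M\<close>-level \<open>m + 2\<close>.\<close>
  have "card (M.pre a) = 2" using twoM[of a] ab Mab[of a] m by simp
  then have "{x \<in> N (Suc i). M x = m} \<noteq> N (Suc i)" using three unfolding eq by auto
  then obtain x3 where x3: "x3 \<in> N (Suc i)" "M x3 \<noteq> m" by blast
  have adj3: "adj a x3" "adj b x3" using preX[OF x3(1)] by (auto simp: in_pre)
  have M3: "M x3 = Suc (Suc m)"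
    using M.L_step[OF adj3(1)] noflatM[OF adj3(1)] m_le[OF x3(1)] x3(2) Mab[of a] by simp
  have "M.pre x3 = {a, b}"
    using card_2_eq_doubleton[OF twoM[of x3]] adj3 N(2) Mab M3 x3(1) by (auto simp: M.in_pre)
  \<comment> \<open>The common successor of \<open>x0\<close> and \<open>x3\<close> lies in
    \<open>M\<close>-level \<open>m + 1\<close>, so it precedes \<open>x3\<close> besides
    \<open>a\<close> and \<open>b\<close>.\<close>
  moreover have "x0 \<noteq> x3" using x0 x3 by auto
  then obtain w where w: "w \<noteq> a" "w \<noteq> b" "adj x0 w" "adj w x3"
    using share[OF x0(1) x3(1)] by blast
  then have "M w = Suc m" using M.L_step[OF w(3)] M.L_step[OF w(4)] x0 M3 by simp
  then have "w \<in> M.pre x3" using w M3 by (simp add: M.in_pre)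
  ultimately show False using w by simp
qed

text \<open>Inner levels have two vertices by induction, the last level has one by parity, and two
  predecessors in a level of two vertices means adjacency to that whole level. The \<open>k\<close>
  sought is the last level \<open>h\<close>.\<close>

lemma candle_levels:
  assumes exact: "exact_levels V adj L"
    and one: "card (N 1) = 2"
    and ends: "\<And>z. z \<in> V \<Longrightarrow> card {u. adj z u} = 2 \<Longrightarrow> \<exists>M. leveled V adj z M \<and> exact_levels V adj M"
    and V: "even (card V)" "4 \<le> card V"
  shows "\<exists>k. card V = 2 * k \<and> 2 \<le> k \<and> (\<forall>i. card (N i) = (if i = 0 \<or> i = k then 1 else if i < k then 2 else 0)) \<and>
    (\<forall>u w. adj u w \<longleftrightarrow> u \<in> V \<and> w \<in> V \<and> (L u = Suc (L w) \<or> L w = Suc (L u)))"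
proof -
  have noflat: "L u \<noteq> L w" if "adj u w" for u w
    using exact that unfolding exact_levels_def by blast
  have two: "card (pre w) = 2" if "w \<in> V" "2 \<le> L w" for w
    using exact that unfolding exact_levels_def by blast
  obtain h where h: "N h \<noteq> {}" "\<And>u. u \<in> V \<Longrightarrow> L u \<le> h" using top_level by blast
  \<comment> \<open>The induction carries a common predecessor \<open>p\<close>, as
    \<open>no_three_in_level\<close> requires. That lemma bounds the next level from above; the two
    predecessors of a vertex one level further bound it from below.\<close>
  have width: "card (N i) = 2 \<and> (\<exists>p. Suc (L p) = i \<and> (\<forall>x\<in>N i. adj p x))"
    and next_le: "card (N (Suc i)) \<le> 2" if "1 \<le> i" "i < h" for i
  proof -
    have step: "card (N (Suc i)) \<le> 2"
      if Ni: "card (N i) = 2" and p: "Suc (L p) = i" "\<forall>x\<in>N i. adj p x" for i p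
    proof -
      obtain a b where "N i = {a, b}" "a \<noteq> b" using Ni by (meson card_2_iff)
      then show ?thesis using p(2) by (intro no_three_in_level[OF exact _ _ p(1) _ _ ends]) auto
    qed
    show w: "card (N i) = 2 \<and> (\<exists>p. Suc (L p) = i \<and> (\<forall>x\<in>N i. adj p x))" using that
    proof (induction i rule: nat_induct_at_least)
      case base
      have "Suc (L r) = 1" using L_zero[OF root_V] by simp
      then show ?case using one N_one by blast
    next
      case (Suc i)
      then obtain p where IH: "card (N i) = 2" "Suc (L p) = i" "\<forall>x\<in>N i. adj p x" by auto
      have "N (Suc (Suc i)) \<noteq> {}" using level_nonempty_below[OF h(1)] Suc.prems by simp
      then obtain w where w: "w \<in> N (Suc (Suc i))" by blast
      have "card (pre w) \<le> card (N (Suc i))" using card_mono[OF finite_N pre_N[OF w]] .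
      then have "card (N (Suc i)) = 2" using step[OF IH] two[of w] w by auto
      moreover obtain a where a: "a \<in> N i" using IH(1) by (metis card.empty equals0I zero_neq_numeral)
      have "adj a x" if "x \<in> N (Suc i)" for x
      proof -
        have "pre x = N i"
          using card_seteq[OF finite_N pre_N[OF that]] two[of x] that Suc.hyps IH(1) by simp
        then show ?thesis using a in_pre by blast
      qed
      ultimately show ?case using a by blast
    qed
    show "card (N (Suc i)) \<le> 2" using step w by blast
  qed
  have "N 1 \<noteq> {}" using one by (metis card.empty zero_neq_numeral)
  then have h1: "1 \<le> h" using h(2) by fastforce
  have VU: "V = (\<Union>i\<in>{..h}. N i)" using h(2) by auto
  have "card (\<Union>i\<in>{..h}. N i) = (\<Sum>i\<le>h. card (N i))"
    using finite_V by (intro card_UN_disjoint) auto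
  then have cV: "card V = (\<Sum>i\<le>h. card (N i))" using VU by simp
  have h2: "2 \<le> h"
  proof (rule ccontr)
    assume "\<not> 2 \<le> h"
    then have "h = Suc 0" using h1 by simp
    then show False using cV V one N_zero by simp
  qed
  have "(\<Sum>i\<le>h. card (N i)) = card (N 0) + (\<Sum>i\<in>{1..<h}. card (N i)) + card (N h)"
  proof -
    have "{..h} = insert 0 (insert h {1..<h})" using h1 by auto
    then show ?thesis using h1 by simp
  qed
  moreover have "(\<Sum>i\<in>{1..<h}. card (N i)) = (\<Sum>i\<in>{1..<h}. 2)"
    using width by (intro sum.cong) auto
  ultimately have cV': "card V = 1 + 2 * (h - 1) + card (N h)"
    using cV N_zero by simp
  have "card (N h) \<le> 2" using next_le[of "h - 1"] h2 by simp
  moreover have "odd (card (N h))" using V(1) unfolding cV' by simp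
  moreover have "odd m \<Longrightarrow> m \<le> 2 \<Longrightarrow> m = 1" for m :: nat by presburger
  ultimately have top: "card (N h) = 1" by blast
  have "card V = 2 * h" using cV' top h1 by simp
  moreover have "card (N i) = (if i = 0 \<or> i = h then 1 else if i < h then 2 else 0)" for i
  proof -
    consider "i = 0" | "i = h" | "1 \<le> i" "i < h" | "h < i" by linarith
    then show ?thesis
    proof cases
      case 1 then show ?thesis using N_zero by simp
    next
      case 2 then show ?thesis using top by simp
    next
      case 3 then show ?thesis using width by simp
    next
      case 4 then have "N i = {}" by (auto dest: h(2))
      then show ?thesis using 4 by (simp only: card.empty) simp
    qed
  qed
  moreover have join: "adj u w" if "u \<in> V" "w \<in> V" "L w = Suc (L u)" for u w
  proof (cases "L u = 0")
    case True
    then show ?thesis using that L_zero[of u] N_one by auto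
  next
    case False
    have "card (N (L u)) = 2" using width[of "L u"] False h(2)[OF that(2)] that(3) by simp
    moreover have "card (pre w) = 2" using two[of w] that False by simp
    moreover have "pre w \<subseteq> N (L u)" using pre_N[of w] that by simp
    ultimately have "pre w = N (L u)" using card_seteq[OF finite_N] by simp
    then have "u \<in> pre w" using that(1) by simp
    then show ?thesis using in_pre by blast
  qed
  have "adj u w \<longleftrightarrow> u \<in> V \<and> w \<in> V \<and> (L u = Suc (L w) \<or> L w = Suc (L u))" for u w
  proof
    assume e: "adj u w"
    show "u \<in> V \<and> w \<in> V \<and> (L u = Suc (L w) \<or> L w = Suc (L u))"
      using adj_V[OF e] adj_V2[OF e] adj_level[OF e] noflat[OF e] by (auto simp: in_pre)
  next
    assume "u \<in> V \<and> w \<in> V \<and> (L u = Suc (L w) \<or> L w = Suc (L u))"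
    then show "adj u w" using join[of u w] join[of w u] adj_sym by blast
  qed
  ultimately show ?thesis using h2 by blast
qed

section \<open>Minimum degree three\<close>

text \<open>Predecessors account for at most two of at least three neighbours, and no neighbour lies
  in the same level.\<close>

lemma min_degree_three_succ:
  assumes "w \<in> V" "3 \<le> card {u. adj w u}" "card (pre w) \<le> 2" "\<And>u. adj w u \<Longrightarrow> L u \<noteq> L w"
  shows "\<exists>u. adj w u \<and> L u = Suc (L w)"
proof (rule ccontr)
  assume "\<not> ?thesis"
  then have "{u. adj w u} = pre w" using nbrs_split[of w] assms(4) by auto
  then show False using assms by simp
qed

text \<open>Minimum degree three supplies the successors that \<open>collapse\<close> asks for; its
  conclusion contradicts the root having degree 3.\<close>

lemma collapse_impossible:
  assumes "card (N 1) = 3" "1 \<le> i" "card (N i) = 2" "s \<in> N (Suc i)" "N i \<subseteq> pre s"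
    and two: "\<And>w. w \<in> V \<Longrightarrow> 2 \<le> L w \<Longrightarrow> L w \<le> i \<Longrightarrow> card (pre w) = 2"
    and deg: "\<And>w. w \<in> V \<Longrightarrow> 3 \<le> card {u. adj w u}"
    and noflat: "\<And>u w. adj w u \<Longrightarrow> L w < i \<Longrightarrow> L u \<noteq> L w"
  shows False
proof -
  have "\<exists>w. adj u w \<and> L w = Suc (L u)" if u: "u \<in> V" "1 \<le> L u" "L u < i" for u
  proof (rule min_degree_three_succ)
    show "card (pre u) \<le> 2"
    proof (cases "L u = 1")
      case True then show ?thesis using pre_one[of u] u by simp
    next
      case False then show ?thesis using two[of u] u by simp
    qed
    show "u \<in> V" by (rule u(1))
    show "3 \<le> card {w. adj u w}" by (rule deg[OF u(1)])
    show "L w \<noteq> L u" if "adj u w" for w using noflat[OF that u(3)] .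
  qed
  then have "card (N 1) = 2" using collapse[OF assms(2-5) two] by blast
  then show False using assms(1) by simp
qed

text \<open>A vertex of the last level has no successor and at most two predecessors, so it lies on
  the only flat edge. The last level is therefore the two ends \<open>p\<close>, \<open>q\<close>,
  and the level below equals \<open>pre p\<close>, which starts a collapse.\<close>

lemma no_flat_edge:
  assumes deg: "\<And>w. w \<in> V \<Longrightarrow> 3 \<le> card {u. adj w u}" and one: "card (N 1) = 3"
    and two: "\<And>w. w \<in> V \<Longrightarrow> 2 \<le> L w \<Longrightarrow> card (pre w) = 2"
    and flat: "card (flat_edges adj L) = 1"
  shows False
proof -
  obtain e where e: "flat_edges adj L = {e}" using flat by (rule card_1_singletonE)
  obtain h where h: "N h \<noteq> {}" "\<And>u. u \<in> V \<Longrightarrow> L u \<le> h" using top_level by blast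
  have flat_e: "{u, w} = e" if "adj u w" "L u = L w" for u w
  proof -
    have "{u, w} \<in> flat_edges adj L" using that unfolding flat_edges_def by blast
    then show ?thesis unfolding e by simp
  qed
  have "N 1 \<noteq> {}" using one by (metis card.empty zero_neq_numeral)
  then have h1: "1 \<le> h" using h(2) by fastforce
  have top_flat: "\<exists>u. adj z u \<and> L u = L z" if z: "z \<in> N h" for z
  proof (rule ccontr)
    assume "\<not> ?thesis"
    moreover have "card (pre z) \<le> 2"
      using two[of z] pre_one[of z] z h1 by (cases "h = 1") auto
    ultimately obtain u where u: "adj z u" "L u = Suc (L z)"
      using min_degree_three_succ[of z] deg[of z] z by blast
    show False using h(2)[OF adj_V2[OF u(1)]] u(2) z by simp
  qed
  obtain p where p: "p \<in> N h" using h(1) by blast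
  obtain q where q: "adj p q" "L q = L p" using top_flat[OF p] by blast
  have qN: "q \<in> N h" using p q(2) adj_V2[OF q(1)] by simp
  have pq: "p \<noteq> q" using q adj_irrefl by blast
  have e': "e = {p, q}" using flat_e[OF q(1)] q(2) by simp
  have Nh: "N h = {p, q}"
  proof
    show "N h \<subseteq> {p, q}"
    proof
      fix z assume "z \<in> N h"
      then obtain u where "adj z u" "L u = L z" using top_flat by blast
      then have "{z, u} = e" using flat_e[of z u] by simp
      then show "z \<in> {p, q}" unfolding e' by blast
    qed
  qed (use p qN in auto)
  have noflat: "L u \<noteq> L w" if "adj w u" "L w < h" for u w
  proof
    assume "L u = L w"
    then have "{u, w} = {p, q}" using flat_e[OF adj_sym[OF that(1)]] e' by simp
    then have "w \<in> {p, q}" by blast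
    then show False using that(2) p q by auto
  qed
  obtain j where j: "h = Suc j" using h1 by (cases h) auto
  \<comment> \<open>Some end \<open>w\<close> of the flat edge is a successor of \<open>u\<close>.
    If the other end \<open>c\<close> were not adjacent to \<open>u\<close>, \<open>quad\<close> on
    \<open>u\<close>, \<open>w\<close>, \<open>c\<close> would give a second middle vertex: either a
    third vertex in the last level or the end of a flat edge in level \<open>j\<close>.\<close>
  have below: "N j \<subseteq> pre c" if cd: "c \<in> {p, q}" for c
  proof
    fix u assume u: "u \<in> N j"
    have "\<exists>w. adj u w \<and> L w = Suc (L u)"
    proof (cases "j = 0")
      case True
      obtain w where "adj w c" "L w = j" using L_pred[of c j] cd p qN j by auto
      then have "w = u" using u True N_zero adj_V[of w c] by auto
      then show ?thesis using \<open>adj w c\<close> cd p q u j by auto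
    next
      case False
      have "card (pre u) \<le> 2" using two[of u] pre_one[of u] u False by (cases "j = 1") auto
      then show ?thesis using min_degree_three_succ[of u] deg[of u] noflat[of u] u j by auto
    qed
    then obtain w where w: "adj u w" "L w = Suc j" using u by auto
    then have w': "w \<in> {p, q}" using Nh j adj_V2 by blast
    show "u \<in> pre c"
    proof (cases "w = c")
      case True then show ?thesis using w u by (simp add: in_pre)
    next
      case False
      then have wc: "adj w c" using w' cd q adj_sym by auto
      have "u \<noteq> c" using cd p qN u j by auto
      moreover have "adj u c"
      proof (rule ccontr)
        assume "\<not> adj u c"
        then obtain y where y: "y \<noteq> w" "adj u y" "adj y c"
          using quad[OF w(1) wc \<open>u \<noteq> c\<close>] by blast
        have Lc: "L c = Suc j" using cd p q j by auto
        have "L y \<noteq> Suc j"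
        proof
          assume "L y = Suc j"
          then have "y \<in> {p, q}" using Nh j adj_V[OF y(3)] by blast
          then show False using y cd w' False adj_irrefl by auto
        qed
        then have "L y = j" using L_step[OF y(3)] L_step[OF y(2)] Lc u by simp
        then show False using noflat[OF y(2)] u j by simp
      qed
      ultimately show ?thesis using u cd p q j by (auto simp: in_pre)
    qed
  qed
  have "j \<noteq> 0"
  proof
    assume "j = 0"
    then have "card (N 1) = 2" using Nh j pq by simp
    then show False using one by simp
  qed
  then have "card (pre p) = 2" using two[of p] p j by simp
  moreover have "N j = pre p" using below[of p] pre_N[of p j] p j by auto
  ultimately have "card (N j) = 2" by simp
  show False
  proof (rule collapse_impossible[OF one _ \<open>card (N j) = 2\<close> _ below[of p] _ deg])
    show "card (pre w) = 2" if "w \<in> V" "2 \<le> L w" for w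
      using two[OF that] .
    show "L u \<noteq> L w" if "adj w u" "L w < j" for u w
      using noflat[OF that(1)] that(2) j by simp
  qed (use \<open>j \<noteq> 0\<close> p j in auto)
qed

text \<open>Only \<open>w0\<close> can lack a successor, so it is alone in the last level, above its
  three predecessors. Any two of these share a predecessor while all three do not, which forces
  three vertices below them, each under a different pair. A further collapse argument puts these
  three in level 1.\<close>

lemma cube_levels:
  assumes deg: "\<And>w. w \<in> V \<Longrightarrow> 3 \<le> card {u. adj w u}" and one: "card (N 1) = 3"
    and noflat: "\<And>u w. adj u w \<Longrightarrow> L u \<noteq> L w"
    and w0: "w0 \<in> V" "2 \<le> L w0" "card (pre w0) = 3"
    and two: "\<And>w. w \<in> V \<Longrightarrow> 2 \<le> L w \<Longrightarrow> w \<noteq> w0 \<Longrightarrow> card (pre w) = 2"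
  shows "\<exists>a1 a2 a3 x1 x2 x3. distinct [r, a1, a2, x1, a3, x2, x3, w0] \<and>
    V = {r, a1, a2, x1, a3, x2, x3, w0} \<and>
    (\<forall>u w. adj u w \<longleftrightarrow> {u, w} \<in> {{r, a1}, {r, a2}, {r, a3}, {a1, x1}, {a2, x1}, {a1, x2}, {a3, x2},
      {a2, x3}, {a3, x3}, {x1, w0}, {x2, w0}, {x3, w0}})"
proof -
  obtain h where h: "N h \<noteq> {}" "\<And>u. u \<in> V \<Longrightarrow> L u \<le> h" using top_level by blast
  have h2: "2 \<le> h" using h(2)[OF w0(1)] w0(2) by simp
  have pre_le: "card (pre u) \<le> 2" if "u \<in> V" "u \<noteq> w0" for u
  proof -
    consider "L u = 0" | "L u = 1" | "2 \<le> L u" by linarith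
    then show ?thesis
    proof cases
      case 1 then show ?thesis using L_zero[OF that(1)] pre_root by simp
    next
      case 2 then show ?thesis using pre_one[of u] that by simp
    next
      case 3 then show ?thesis using two that by simp
    qed
  qed
  have succ: "\<exists>w. adj u w \<and> L w = Suc (L u)" if "u \<in> V" "u \<noteq> w0" for u
    using min_degree_three_succ[OF that(1) deg[OF that(1)] pre_le[OF that]] noflat by metis
  have Nh: "N h = {w0}"
  proof -
    have "z = w0" if "z \<in> N h" for z
      using succ[of z] h(2) adj_V2 that by fastforce
    then show ?thesis using h(1) by blast
  qed
  then have Lw0: "L w0 = h" by auto
  have w0_only: "u \<noteq> w0" if "L u < h" for u using that Lw0 by auto
  obtain i where i: "h = Suc (Suc i)" using h2 by (metis add_2_eq_Suc less_eqE)
  have Npre: "N (Suc i) = pre w0"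
  proof
    show "pre w0 \<subseteq> N (Suc i)" using pre_N[of w0 "Suc i"] w0(1) Lw0 i by simp
    show "N (Suc i) \<subseteq> pre w0"
    proof
      fix u assume u: "u \<in> N (Suc i)"
      then obtain w where w: "adj u w" "L w = h" using succ[of u] w0_only[of u] i by auto
      then have "w = w0" using Nh adj_V2 by blast
      then show "u \<in> pre w0" using w u i by (simp add: in_pre)
    qed
  qed
  then obtain x1 x2 x3 where x: "N (Suc i) = {x1, x2, x3}" "x1 \<noteq> x2" "x2 \<noteq> x3" "x1 \<noteq> x3"
    using w0(3) by (metis card_3_iff)
  have xV: "x \<in> V" "L x = Suc i" "adj x w0" if "x \<in> {x1, x2, x3}" for x
    using that x(1) Npre in_pre by blast+
  have i0: "i \<noteq> 0"
  proof
    assume i0: "i = 0"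
    have x1: "x1 \<in> N 1" using xV[of x1] i0 by simp
    have "{u. adj x1 u} \<subseteq> {r, w0}"
    proof
      fix u assume "u \<in> {u. adj x1 u}"
      then have u: "adj x1 u" by simp
      then consider "u \<in> pre x1" | "L u = h"
        using adj_level[OF u] noflat[OF u] x1 i i0 by (auto simp: in_pre)
      then show "u \<in> {r, w0}"
      proof cases
        case 1 then show ?thesis using pre_one[OF x1] by blast
      next
        case 2 then show ?thesis using Nh adj_V2[OF u] by blast
      qed
    qed
    then have "card {u. adj x1 u} \<le> card {r, w0}" by (intro card_mono) auto
    also have "\<dots> \<le> 2" by (simp add: card_insert_if)
    finally show False using deg[of x1] x1 by simp
  qed
  have prex: "card (pre x) = 2" "pre x \<subseteq> N i" if "x \<in> {x1, x2, x3}" for x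
    using two[of x] xV[OF that] w0_only[of x] i i0 pre_N[of x i] by auto
  \<comment> \<open>By \<open>two_step\<close> on the path from \<open>u\<close> through
    \<open>x\<close> to \<open>w0\<close>.\<close>
  have twosucc: "\<exists>y \<in> {x1, x2, x3}. y \<noteq> x \<and> u \<in> pre y" if xx: "x \<in> {x1, x2, x3}" and ux: "u \<in> pre x" for u x
  proof -
    have "adj u x" "Suc (L u) = L x" using ux in_pre by auto
    then obtain y where y: "y \<noteq> x" "adj u y" "L y = Suc (L u)"
      using two_step[of u x w0] xV[OF xx] Lw0 i by auto
    then have "y \<in> N (Suc i)" using adj_V2 \<open>Suc (L u) = L x\<close> xV[OF xx] by auto
    then show ?thesis using y x(1) by (auto simp: in_pre)
  qed
  have someX: "\<exists>x \<in> {x1, x2, x3}. u \<in> pre x" if u: "u \<in> N i" for u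
  proof -
    obtain w where w: "adj u w" "L w = Suc (L u)" using succ[of u] w0_only[of u] u i by auto
    then have "w \<in> N (Suc i)" using u adj_V2 by auto
    then show ?thesis using w x(1) by (auto simp: in_pre)
  qed
  \<comment> \<open>\<open>x\<close> and \<open>y\<close> have the common neighbour
    \<open>w0\<close>; the second one given by \<open>quad\<close> cannot lie in the last
    level.\<close>
  have share: "\<exists>u. u \<in> pre x \<and> u \<in> pre y" if xy: "x \<in> {x1, x2, x3}" "y \<in> {x1, x2, x3}" "x \<noteq> y" for x y
  proof -
    have "\<not> adj x y" using noflat[of x y] xV xy by auto
    then obtain u where u: "u \<noteq> w0" "adj x u" "adj u y"
      using quad[of x w0 y] xV(3)[OF xy(1)] adj_sym[OF xV(3)[OF xy(2)]] xy(3) by blast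
    have "L u \<noteq> h" using Nh u adj_V by blast
    then have "L u = i" using adj_level[OF u(2)] noflat[OF u(2)] xV[OF xy(1)] i by (auto simp: in_pre)
    then show ?thesis using u adj_sym xV xy by (auto simp: in_pre)
  qed
  have no_collapse: False
    if "1 \<le> j" "card (N j) = 2" "s \<in> N (Suc j)" "N j \<subseteq> pre s" "Suc j < h" for j s
  proof (rule collapse_impossible[OF one that(1-4) _ deg])
    show "card (pre w) = 2" if "w \<in> V" "2 \<le> L w" "L w \<le> j" for w
      using two[OF that(1,2)] w0_only[of w] that(3) \<open>Suc j < h\<close> by simp
    show "L u \<noteq> L w" if "adj w u" for u w
      using noflat[OF that] by simp
  qed
  \<comment> \<open>Each \<open>pre x\<close> is then \<open>c\<close> with one further vertex. By
    \<open>twosucc\<close> each further vertex belongs to at least two of the three, so two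
    different ones would need four. Hence level \<open>i\<close> has two vertices and
    collapses.\<close>
  have no_common: False if c: "c \<in> pre x1" "c \<in> pre x2" "c \<in> pre x3" for c
  proof -
    have cpre: "c \<in> pre x" if "x \<in> {x1, x2, x3}" for x using c that by blast
    obtain s where s: "s \<in> pre x1" "s \<noteq> c"
      using prex(1)[of x1] c(1) by (metis card_2_iff insertCI)
    have others: "pre x = {c, t}" if "x \<in> {x1, x2, x3}" "t \<in> pre x" "t \<noteq> c" for x t
      using card_2_eq_doubleton[OF prex(1)[OF that(1)] cpre[OF that(1)] that(2)] that(3) by blast
    have all: "u \<in> {c, s}" if u: "u \<in> pre x" "x \<in> {x1, x2, x3}" for u x
    proof (rule ccontr)
      assume nu: "u \<notin> {c, s}"
      obtain y where y: "y \<in> {x1, x2, x3}" "y \<noteq> x" "u \<in> pre y" using twosucc[OF u(2,1)] by blast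
      have pu: "pre x = {c, u}" "pre y = {c, u}" using others[OF u(2,1)] others[OF y(1,3)] nu by auto
      have p1: "pre x1 = {c, s}" using others[of x1 s] s by simp
      obtain y' where y': "y' \<in> {x1, x2, x3}" "y' \<noteq> x1" "s \<in> pre y'" using twosucc[of x1 s] s by blast
      have p2: "pre y' = {c, s}" using others[OF y'(1,3)] s by simp
      have "x \<noteq> x1" "y \<noteq> x1" "x \<noteq> y'" "y \<noteq> y'" using pu p1 p2 nu s by auto
      then show False using u(2) y(1,2) y'(1,2) by blast
    qed
    have "N i = pre x1"
    proof
      show "N i \<subseteq> pre x1" using someX all others[of x1 s] s by blast
    qed (use prex(2)[of x1] in blast)
    then show False using no_collapse[of i x1] prex(1)[of x1] xV[of x1] i0 i by simp
  qed
  obtain a1 where a1: "a1 \<in> pre x1" "a1 \<in> pre x2" using share[of x1 x2] x by blast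
  obtain a2 where a2: "a2 \<in> pre x1" "a2 \<in> pre x3" using share[of x1 x3] x by blast
  obtain a3 where a3: "a3 \<in> pre x2" "a3 \<in> pre x3" using share[of x2 x3] x by blast
  have a: "a1 \<noteq> a2" "a1 \<noteq> a3" "a2 \<noteq> a3" using no_common a1 a2 a3 by blast+
  have p: "pre x1 = {a1, a2}" "pre x2 = {a1, a3}" "pre x3 = {a2, a3}"
    using card_2_eq_doubleton[OF prex(1)] a1 a2 a3 a by auto
  have Ni: "N i = {a1, a2, a3}"
  proof
    show "N i \<subseteq> {a1, a2, a3}" using someX p by blast
    show "{a1, a2, a3} \<subseteq> N i" using prex(2) p by blast
  qed
  \<comment> \<open>Otherwise a vertex \<open>u\<close> of the level below is adjacent to some
    \<open>a1\<close>, \<open>a2\<close> or \<open>a3\<close>. Any two of these are the whole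
    predecessor set of one \<open>x\<close>, so \<open>two_step\<close> towards it passes adjacency
    on to the other. Thus that level equals \<open>pre a1\<close> and collapses.\<close>
  have i1: "i = 1"
  proof (rule ccontr)
    assume "i \<noteq> 1"
    then obtain k where k: "i = Suc k" "1 \<le> k" using i0 by (cases i) auto
    have aN: "c \<in> V" "L c = i" if "c \<in> {a1, a2, a3}" for c using that Ni by blast+
    have c2: "c2 \<in> {a1, a2, a3} \<and> adj u c2"
      if uc: "adj u c" "L u = k" and cx: "c \<in> pre x" "pre x = {c, c2}" and xx: "x \<in> {x1, x2, x3}"
      for u c c2 x
    proof -
      have "adj c x" using cx(1) in_pre by blast
      then obtain y where y: "y \<noteq> c" "adj u y" "adj y x" "L y = Suc (L u)"
        using two_step[OF uc(1), of x] xV[OF xx] uc(2) k by auto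
      then have "y \<in> pre x" using xV[OF xx] uc(2) k by (simp add: in_pre)
      then have "y = c2" using cx(2) y(1) by blast
      then show ?thesis using y \<open>y \<in> pre x\<close> prex(2)[OF xx] Ni by blast
    qed
    have "N k \<subseteq> pre a1"
    proof
      fix u assume u: "u \<in> N k"
      obtain w where w: "adj u w" "L w = Suc (L u)" using succ[of u] w0_only[of u] u i k by auto
      then have "w \<in> N i" using u k adj_V2 by auto
      then have "w \<in> {a1, a2, a3}" using Ni by blast
      moreover have "adj u a1" if "adj u a2" using c2[of u a2 x1 a1] u that p(1) by auto
      moreover have "adj u a1" if "adj u a3" using c2[of u a3 x2 a1] u that p(2) by auto
      ultimately have "adj u a1" using w(1) by blast
      then show "u \<in> pre a1" using u aN[of a1] k by (simp add: in_pre)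
    qed
    then have "N k = pre a1" using pre_N[of a1 k] aN[of a1] k by blast
    moreover have "card (pre a1) = 2" using two[of a1] aN[of a1] k i w0_only[of a1] by simp
    ultimately show False
      using no_collapse[of k a1] k i aN[of a1] by simp
  qed
  have pa: "pre c = {r}" if "c \<in> {a1, a2, a3}" for c
    using pre_one[of c] Ni i1 that by blast
  have V: "V = {r, a1, a2, x1, a3, x2, x3, w0}"
  proof -
    have h3: "h = 3" using i i1 by simp
    have "V = N 0 \<union> N 1 \<union> N 2 \<union> N 3"
    proof
      show "V \<subseteq> N 0 \<union> N 1 \<union> N 2 \<union> N 3"
      proof
        fix u assume "u \<in> V"
        moreover have "L u = 0 \<or> L u = 1 \<or> L u = 2 \<or> L u = 3" using h(2)[OF \<open>u \<in> V\<close>] h3 by auto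
        ultimately show "u \<in> N 0 \<union> N 1 \<union> N 2 \<union> N 3" by auto
      qed
    qed auto
    moreover have "N 2 = {x1, x2, x3}" "N 1 = {a1, a2, a3}" "N 3 = {w0}"
      using x(1) Ni Nh i1 h3 by (simp_all add: numeral_2_eq_2)
    ultimately show ?thesis using N_zero by auto
  qed
  have "a1 \<in> N 1" "a2 \<in> N 1" "a3 \<in> N 1" using Ni i1 by blast+
  then have La: "L a1 = 1" "L a2 = 1" "L a3 = 1" by simp_all
  have Lx: "L x1 = 2" "L x2 = 2" "L x3 = 2" using xV(2) i1 by simp_all
  have Lr: "L r = 0" and Lw: "L w0 = 3" using L_zero[OF root_V] Lw0 i i1 by simp_all
  have "distinct [r, a1, a2, x1, a3, x2, x3, w0]"
  proof -
    have "L u \<noteq> L w \<Longrightarrow> u \<noteq> w" for u w by blast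
    then have "r \<noteq> a1" "r \<noteq> a2" "r \<noteq> a3" "r \<noteq> x1" "r \<noteq> x2" "r \<noteq> x3" "r \<noteq> w0"
      "a1 \<noteq> x1" "a1 \<noteq> x2" "a1 \<noteq> x3" "a2 \<noteq> x1" "a2 \<noteq> x2" "a2 \<noteq> x3" "x1 \<noteq> a3" "a3 \<noteq> x2" "a3 \<noteq> x3"
      "a1 \<noteq> w0" "a2 \<noteq> w0" "a3 \<noteq> w0" "x1 \<noteq> w0" "x2 \<noteq> w0" "x3 \<noteq> w0"
      by (simp_all add: La Lx Lr Lw)
    then show ?thesis using a x by simp
  qed
  moreover have "adj u w \<longleftrightarrow> {u, w} \<in> {{r, a1}, {r, a2}, {r, a3}, {a1, x1}, {a2, x1}, {a1, x2}, {a3, x2},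
      {a2, x3}, {a3, x3}, {x1, w0}, {x2, w0}, {x3, w0}}" (is "_ \<longleftrightarrow> _ \<in> ?E") for u w
  proof
    have pw: "pre w0 = {x1, x2, x3}" using Npre x(1) by simp
    have up: "{u, w} \<in> ?E" if "u \<in> pre w" for u w
    proof -
      have "w \<in> V" using that adj_V2 in_pre by blast
      then have "w \<in> {r, a1, a2, x1, a3, x2, x3, w0}" by (subst (asm) V)
      then consider "w = r" | "w \<in> {a1, a2, a3}" | "w = x1" | "w = x2" | "w = x3" | "w = w0"
        by (elim insertE) auto
      then show ?thesis
      proof cases
        case 1 then show ?thesis using that pre_root by simp
      next
        case 2
        have "u = r" using that unfolding pa[OF 2] by simp
        then show ?thesis using 2 by (elim insertE emptyE) simp_all
      next
        case 3
        then have "u \<in> {a1, a2}" using that p(1) by simp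
        then show ?thesis using 3 by (elim insertE emptyE) simp_all
      next
        case 4
        then have "u \<in> {a1, a3}" using that p(2) by simp
        then show ?thesis using 4 by (elim insertE emptyE) simp_all
      next
        case 5
        then have "u \<in> {a2, a3}" using that p(3) by simp
        then show ?thesis using 5 by (elim insertE emptyE) simp_all
      next
        case 6
        then have "u \<in> {x1, x2, x3}" using that pw by simp
        then show ?thesis using 6 by (elim insertE emptyE) simp_all
      qed
    qed
    show "{u, w} \<in> ?E" if "adj u w"
    proof -
      have "u \<in> pre w \<or> w \<in> pre u" using adj_level[OF that] noflat[OF that] by blast
      then show ?thesis
      proof
        assume "w \<in> pre u"
        from up[OF this] show ?thesis by (subst insert_commute)
      qed (rule up)
    qed
    have e: "adj r a1" "adj r a2" "adj r a3" "adj a1 x1" "adj a2 x1" "adj a1 x2" "adj a3 x2"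
      "adj a2 x3" "adj a3 x3" "adj x1 w0" "adj x2 w0" "adj x3 w0"
    proof -
      have "u \<in> pre w \<Longrightarrow> adj u w" for u w using in_pre by blast
      then show "adj r a1" "adj r a2" "adj r a3" "adj a1 x1" "adj a2 x1" "adj a1 x2" "adj a3 x2"
        "adj a2 x3" "adj a3 x3" "adj x1 w0" "adj x2 w0" "adj x3 w0"
        by (simp_all add: pa p pw)
    qed
    show "adj u w" if "{u, w} \<in> ?E"
    proof -
      have "adj u w" if "{u, w} = {c, d}" "adj c d" for c d
        using that adj_sym by (metis doubleton_eq_iff)
      then show ?thesis using that e by (elim insertE emptyE) blast+
    qed
  qed
  ultimately show ?thesis using V by blast
qed

end

section \<open>Graphs of matrices with two eigenvalues, and isomorphisms\<close>

text \<open>For nonadjacent distinct vertices the entries of \<open>A\<close> and of the identity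
  vanish, hence so does that of \<open>A * A\<close>, a sum of nonzero products over the common
  neighbours. Such a sum cannot have exactly one term.\<close>

lemma quad_graph_of_two_eigenvalues:
  fixes A :: "real mat"
  assumes E: "is_graph n E" and A: "A \<in> sym_pattern n E"
    and sq: "A * A = c \<cdot>\<^sub>m A - d \<cdot>\<^sub>m 1\<^sub>m n"
  shows "quad_graph {0..<n} (\<lambda>u w. {u, w} \<in> E)"
proof -
  let ?adj = "\<lambda>u w. {u, w} \<in> E"
  have carr: "A \<in> carrier_mat n n" and AT: "A\<^sup>T = A"
    and pat: "\<And>i j. i < n \<Longrightarrow> j < n \<Longrightarrow> i \<noteq> j \<Longrightarrow> A $$ (i, j) \<noteq> 0 \<longleftrightarrow> {i, j} \<in> E"
    using A unfolding sym_pattern_def by auto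
  have symA: "A $$ (i, j) = A $$ (j, i)" if "i < n" "j < n" for i j
    using that carr arg_cong[OF AT, of "\<lambda>M. M $$ (i, j)"] by simp
  have lt: "u < n" "w < n" "u \<noteq> w" if "?adj u w" for u w
  proof -
    obtain i j where "i < n" "j < n" "i \<noteq> j" "{u, w} = {i, j}"
      using E \<open>?adj u w\<close> unfolding is_graph_def by blast
    then show "u < n" "w < n" "u \<noteq> w" by (auto simp: doubleton_eq_iff)
  qed
  have sym: "?adj w u" if "?adj u w" for u w using that by (simp add: insert_commute)
  have nz: "A $$ (u, w) \<noteq> 0" if "?adj u w" for u w using pat lt[OF that] that by blast
  have orth: "(\<Sum>k\<in>{k. ?adj u k \<and> ?adj k w}. A $$ (u, k) * A $$ (k, w)) = 0"
    if uw: "u < n" "w < n" "u \<noteq> w" "\<not> ?adj u w" for u w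
  proof -
    have zero: "A $$ (u, w) = 0" using pat uw by blast
    have "(A * A) $$ (u, w) = 0" unfolding sq using uw carr zero by simp
    then have "(\<Sum>k\<in>{0..<n}. A $$ (u, k) * A $$ (k, w)) = 0"
      using uw carr by (simp add: scalar_prod_def)
    moreover have "(\<Sum>k\<in>{k. ?adj u k \<and> ?adj k w}. A $$ (u, k) * A $$ (k, w)) =
        (\<Sum>k\<in>{0..<n}. A $$ (u, k) * A $$ (k, w))"
    proof (rule sum.mono_neutral_left)
      show "{k. ?adj u k \<and> ?adj k w} \<subseteq> {0..<n}" using lt by auto
      show "\<forall>k\<in>{0..<n} - {k. ?adj u k \<and> ?adj k w}. A $$ (u, k) * A $$ (k, w) = 0"
      proof
        fix k assume k: "k \<in> {0..<n} - {k. ?adj u k \<and> ?adj k w}"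
        show "A $$ (u, k) * A $$ (k, w) = 0"
        proof (cases "k = u \<or> k = w")
          case True then show ?thesis using zero by auto
        next
          case False
          then show ?thesis using k pat[of u k] pat[of k w] uw by auto
        qed
      qed
    qed simp
    ultimately show ?thesis by simp
  qed
  show ?thesis
  proof
    show "\<not> ?adj u u" for u using lt(3) by blast
    show "\<exists>y. y \<noteq> x \<and> ?adj u y \<and> ?adj y w"
      if h: "?adj u x" "?adj x w" "u \<noteq> w" "\<not> ?adj u w" for u x w
    proof (rule ccontr)
      assume "\<not> ?thesis"
      then have "{k. ?adj u k \<and> ?adj k w} = {x}" using h by blast
      then have "A $$ (u, x) * A $$ (x, w) = 0"
        using orth[OF lt(1)[OF h(1)] lt(2)[OF h(2)] h(3,4)] by simp
      then show False using nz[OF h(1)] nz[OF h(2)] by simp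
    qed
    show "\<exists>w. w \<noteq> a \<and> w \<noteq> b \<and> ?adj x w \<and> ?adj w y"
      if h: "{u. ?adj p u \<and> ?adj u x} = {a, b}" "{u. ?adj p u \<and> ?adj u y} = {a, b}" "a \<noteq> b"
        "p \<noteq> x" "p \<noteq> y" "x \<noteq> y" "\<not> ?adj p x" "\<not> ?adj p y" "\<not> ?adj x y" for p x y a b
    proof (rule ccontr)
      assume no: "\<not> ?thesis"
      have "a \<in> {u. ?adj p u \<and> ?adj u x}" "b \<in> {u. ?adj p u \<and> ?adj u x}"
        "a \<in> {u. ?adj p u \<and> ?adj u y}" "b \<in> {u. ?adj p u \<and> ?adj u y}"
        unfolding h(1,2) by simp_all
      then have e: "?adj p a" "?adj p b" "?adj a x" "?adj b x" "?adj a y" "?adj b y" by simp_all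
      have xy: "{u. ?adj x u \<and> ?adj u y} = {a, b}"
        using no e sym[OF e(3)] sym[OF e(4)] by blast
      note l = lt(1)[OF e(1)] lt(2)[OF e(3)] lt(2)[OF e(5)] lt(2)[OF e(1)] lt(2)[OF e(2)]
      define P Q where "P = A $$ (p, a)" and "Q = A $$ (p, b)"
      define X Y where "X = A $$ (a, x)" and "Y = A $$ (b, x)"
      define Z W where "Z = A $$ (a, y)" and "W = A $$ (b, y)"
      have 1: "P * X + Q * Y = 0"
        using orth[OF l(1,2) h(4,7)] unfolding h(1) P_def Q_def X_def Y_def using h(3) by simp
      have 2: "P * Z + Q * W = 0"
        using orth[OF l(1,3) h(5,8)] unfolding h(2) P_def Q_def Z_def W_def using h(3) by simp
      have 3: "X * Z + Y * W = 0"
        using orth[OF l(2,3) h(6,9)] unfolding xy X_def Y_def Z_def W_def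
        using h(3) symA[OF l(2,4)] symA[OF l(2,5)] by simp
      \<comment> \<open>In the plane, (X, Y) and (Z, W) are both orthogonal to (P, Q) and to each
        other. Replacing P X and P Z through the first two relations brings out the factor of the
        third.\<close>
      have "(P * P + Q * Q) * (X * Z) = (P * X) * (P * Z) + Q * Q * (X * Z)"
        by (simp add: algebra_simps)
      also have "\<dots> = (- (Q * Y)) * (- (Q * W)) + Q * Q * (X * Z)"
        unfolding eq_neg_iff_add_eq_0[THEN iffD2, OF 1] eq_neg_iff_add_eq_0[THEN iffD2, OF 2] ..
      also have "\<dots> = Q * Q * (X * Z + Y * W)" by (simp add: algebra_simps)
      finally have "(P * P + Q * Q) * (X * Z) = 0" using 3 by simp
      moreover have "P \<noteq> 0" "X \<noteq> 0" "Z \<noteq> 0" unfolding P_def X_def Z_def using nz e by auto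
      ultimately show False by (simp add: sum_squares_eq_zero_iff)
    qed
  qed (use lt sym in auto)
qed

section \<open>Isomorphisms onto the candle and the cube\<close>

lemma ex_bij_betw_fibres:
  assumes V: "finite V" and W: "finite W" and fib: "\<And>i. card {u \<in> V. L u = i} = card {w \<in> W. K w = i}"
  shows "\<exists>f. bij_betw f V W \<and> (\<forall>u\<in>V. K (f u) = L u)"
proof -
  have "\<exists>g. bij_betw g {u \<in> V. L u = i} {w \<in> W. K w = i}" for i
    using V W fib by (intro finite_same_card_bij) auto
  then obtain g where g: "\<And>i. bij_betw (g i) {u \<in> V. L u = i} {w \<in> W. K w = i}" by metis
  have fu: "g (L u) u \<in> W \<and> K (g (L u) u) = L u" if "u \<in> V" for u
    using bij_betwE[OF g[of "L u"]] that by auto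
  have "bij_betw (\<lambda>u. g (L u) u) V W"
  proof (rule bij_betw_imageI)
    show "inj_on (\<lambda>u. g (L u) u) V"
    proof (rule inj_onI)
      fix u v assume uv: "u \<in> V" "v \<in> V" "g (L u) u = g (L v) v"
      then have "L u = L v" using fu by metis
      with uv show "u = v" using bij_betw_imp_inj_on[OF g[of "L u"]] by (auto simp: inj_on_def)
    qed
    show "(\<lambda>u. g (L u) u) ` V = W"
    proof
      show "W \<subseteq> (\<lambda>u. g (L u) u) ` V"
      proof
        fix w assume "w \<in> W"
        then have "w \<in> g (K w) ` {u \<in> V. L u = K w}" using bij_betw_imp_surj_on[OF g[of "K w"]] by blast
        then obtain u where "u \<in> V" "L u = K w" "w = g (K w) u" by blast
        then have "w = g (L u) u" by simp
        with \<open>u \<in> V\<close> show "w \<in> (\<lambda>u. g (L u) u) ` V" by blast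
      qed
    qed (use fu in auto)
  qed
  with fu show ?thesis by blast
qed

lemma candle_level_card:
  fixes k i :: nat
  assumes "1 \<le> k"
  shows "card {y \<in> {0..<2 * k}. (y + 1) div 2 = i} = (if i = 0 \<or> i = k then 1 else if i < k then 2 else 0)"
proof -
  consider "i = 0" | "i = k" | "1 \<le> i" "i < k" | "k < i" by linarith
  then show ?thesis
  proof cases
    case 1
    then have "{y \<in> {0..<2 * k}. (y + 1) div 2 = i} = {0}" using assms by auto
    with 1 show ?thesis by simp
  next
    case 2
    then have "{y \<in> {0..<2 * k}. (y + 1) div 2 = i} = {2 * k - 1}" using assms by auto
    with 2 show ?thesis by simp
  next
    case 3
    then have "{y \<in> {0..<2 * k}. (y + 1) div 2 = i} = {2 * i - 1, 2 * i}" by auto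
    then show ?thesis using 3 by simp
  next
    case 4
    then have "{y \<in> {0..<2 * k}. (y + 1) div 2 = i} = {}" by auto
    then show ?thesis using 4 by (simp only: card.empty) simp
  qed
qed

text \<open>Adjacency depends on the levels alone in both graphs, so any level-preserving bijection
  is an isomorphism, and equal level sizes provide one.\<close>

lemma graph_iso_candle:
  assumes k: "1 \<le> k"
    and lev: "\<And>i. card {u \<in> {0..<2 * k}. L u = i} = (if i = 0 \<or> i = k then 1 else if i < k then 2 else 0)"
    and adj: "\<And>u w. {u, w} \<in> E \<longleftrightarrow> u < 2 * k \<and> w < 2 * k \<and> (L u = Suc (L w) \<or> L w = Suc (L u))"
  shows "graph_iso (2 * k) E (2 * k) (candle_edges k)"
proof -
  have "\<exists>f. bij_betw f {0..<2 * k} {0..<2 * k} \<and> (\<forall>u\<in>{0..<2 * k}. (f u + 1) div 2 = L u)"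
    by (rule ex_bij_betw_fibres) (simp_all only: finite_atLeastLessThan lev candle_level_card[OF k])
  then obtain f where f: "bij_betw f {0..<2 * k} {0..<2 * k}"
    "\<And>u. u < 2 * k \<Longrightarrow> (f u + 1) div 2 = L u" by auto
  have mem: "{x, y} \<in> candle_edges k \<longleftrightarrow> x < 2 * k \<and> y < 2 * k \<and>
      ((x + 1) div 2 = Suc ((y + 1) div 2) \<or> (y + 1) div 2 = Suc ((x + 1) div 2))" for x y
    unfolding candle_edges_def by (auto simp: doubleton_eq_iff)
  have "{u, w} \<in> E \<longleftrightarrow> {f u, f w} \<in> candle_edges k" if "u < 2 * k" "w < 2 * k" for u w
  proof -
    have "f u < 2 * k" "f w < 2 * k" using bij_betwE[OF f(1)] that by auto
    then show ?thesis unfolding mem adj f(2)[OF that(1)] f(2)[OF that(2)] using that by simp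
  qed
  then show ?thesis unfolding graph_iso_def using f(1) by blast
qed

lemma Q3_edges_eq:
  "Q3_edges = {{0, 1}, {0, 2}, {0, 4}, {1, 3}, {2, 3}, {1, 5}, {4, 5}, {2, 6}, {4, 6}, {3, 7}, {5, 7}, {6, 7}}"
    (is "_ = ?E")
proof -
  \<comment> \<open>The number of differing bits becomes an arithmetic sum that the simplifier can
    evaluate.\<close>
  have card3: "card {i. i < (3::nat) \<and> P i} = of_bool (P 0) + of_bool (P 1) + of_bool (P 2)" for P
  proof -
    have "card {i. i < (3::nat) \<and> P i} = (\<Sum>i\<in>{i. i < 3 \<and> P i}. 1)" by simp
    also have "\<dots> = (\<Sum>i<3. of_bool (P i))"
      by (rule sum.mono_neutral_cong_left) auto
    finally show ?thesis by (simp add: numeral_3_eq_3 numeral_2_eq_2)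
  qed
  have lt8: "u = 0 \<or> u = 1 \<or> u = 2 \<or> u = 3 \<or> u = 4 \<or> u = 5 \<or> u = 6 \<or> u = 7" if "u < 8" for u :: nat
    using that by linarith
  have Q: "Q3_edges = {{u, v} |u v. u < 8 \<and> v < 8 \<and>
      of_bool (odd u \<noteq> odd v) + of_bool (odd (u div 2) \<noteq> odd (v div 2)) +
      of_bool (odd (u div 4) \<noteq> odd (v div 4)) = (1 :: nat)}"
    unfolding Q3_edges_def card3 by simp
  show ?thesis
  proof
    show "Q3_edges \<subseteq> ?E"
    proof
      fix e assume "e \<in> Q3_edges"
      then obtain u v where e: "e = {u, v}" and uv: "u < 8" "v < 8" and
        c: "of_bool (odd u \<noteq> odd v) + of_bool (odd (u div 2) \<noteq> odd (v div 2)) +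
          of_bool (odd (u div 4) \<noteq> odd (v div 4)) = (1 :: nat)"
        unfolding Q by blast
      show "e \<in> ?E"
        unfolding e using lt8[OF uv(1)] lt8[OF uv(2)] c
        by (elim disjE) (simp_all add: doubleton_eq_iff)
    qed
    have "{u, v} \<in> Q3_edges" if "u < 8" "v < 8" "of_bool (odd u \<noteq> odd v) + of_bool (odd (u div 2) \<noteq> odd (v div 2)) +
      of_bool (odd (u div 4) \<noteq> odd (v div 4)) = (1 :: nat)" for u v
      unfolding Q using that by blast
    then show "?E \<subseteq> Q3_edges" by simp
  qed
qed

text \<open>The list is ordered so that a vertex stands at the position given by its binary label:
  \<open>a1\<close>, \<open>a2\<close>, \<open>a3\<close> at 1, 2, 4 and each \<open>x\<close> at
  the sum of its two predecessors.\<close>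

lemma graph_iso_cube:
  assumes "distinct [r, a1, a2, x1, a3, x2, x3, w0]"
    and "{0..<n} = {r, a1, a2, x1, a3, x2, x3, w0}"
    and "\<forall>u w. {u, w} \<in> E \<longleftrightarrow> {u, w} \<in> {{r, a1}, {r, a2}, {r, a3}, {a1, x1}, {a2, x1}, {a1, x2}, {a3, x2},
      {a2, x3}, {a3, x3}, {x1, w0}, {x2, w0}, {x3, w0}}"
  shows "graph_iso n E 8 Q3_edges"
proof -
  define xs where "xs = [r, a1, a2, x1, a3, x2, x3, w0]"
  let ?g = "(!) xs"
  have bij: "bij_betw ?g {0..<8} {0..<n}"
    using assms(1,2) by (intro bij_betw_nth) (auto simp: xs_def)
  have img: "{{r, a1}, {r, a2}, {r, a3}, {a1, x1}, {a2, x1}, {a1, x2}, {a3, x2},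
      {a2, x3}, {a3, x3}, {x1, w0}, {x2, w0}, {x3, w0}} = (`) ?g ` Q3_edges"
    unfolding Q3_edges_eq xs_def by (simp add: insert_commute)
  have sub: "Q3_edges \<subseteq> Pow {0..<8}" unfolding Q3_edges_eq by simp
  have inj: "inj_on ((`) ?g) (Pow {0..<8})"
    using inj_on_image_Pow[OF bij_betw_imp_inj_on[OF bij]] .
  let ?f = "inv_into {0..<8} ?g"
  have f: "bij_betw ?f {0..<n} {0..<8}" by (rule bij_betw_inv_into[OF bij])
  have "{u, w} \<in> E \<longleftrightarrow> {?f u, ?f w} \<in> Q3_edges" if "u < n" "w < n" for u w
  proof -
    have "?g (?f u) = u" "?g (?f w) = w" using bij_betw_inv_into_right[OF bij] that by auto
    then have eq: "{u, w} = ?g ` {?f u, ?f w}" by simp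
    have "{?f u, ?f w} \<in> Pow {0..<8}" using bij_betwE[OF f] that by simp
    then have "{?f u, ?f w} \<in> Q3_edges \<longleftrightarrow> ?g ` {?f u, ?f w} \<in> (`) ?g ` Q3_edges"
      using inj_on_image_mem_iff[OF inj _ sub] by blast
    then show ?thesis using assms(3)[rule_format, of u w] unfolding img eq[symmetric] by simp
  qed
  then show ?thesis unfolding graph_iso_def using f by blast
qed

text \<open>The adjacency matrix is a witness, so the \<open>LEAST\<close> in \<open>q_graph\<close>
  is attained by some matrix.\<close>

lemma sym_pattern_nonempty: "sym_pattern n E \<noteq> {}"
proof -
  define A where "A = mat n n (\<lambda>(i, j). if {i, j} \<in> E then 1 else (0::real))"
  have "A\<^sup>T = A"
    by (rule eq_matI) (auto simp: A_def insert_commute)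
  then have "A \<in> sym_pattern n E"
    unfolding sym_pattern_def by (auto simp: A_def)
  then show ?thesis by blast
qed

section \<open>From q(G) = 2 to the two families of graphs\<close>

lemma quad_graph_if_q_two:
  assumes "is_graph n E" "q_graph n E = 2"
  shows "quad_graph {0..<n} (\<lambda>u w. {u, w} \<in> E)"
proof -
  have "\<exists>k. \<exists>A\<in>sym_pattern n E. card {x. eigenvalue A x} = k"
    using sym_pattern_nonempty by blast
  from LeastI_ex[OF this] obtain A where A: "A \<in> sym_pattern n E" "card {x. eigenvalue A x} = 2"
    using assms(2) unfolding q_graph_def by auto
  then obtain a b where "{x. eigenvalue A x} = {a, b}" by (meson card_2_iff)
  then have "A * A = (a + b) \<cdot>\<^sub>m A - (a * b) \<cdot>\<^sub>m 1\<^sub>m n"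
    using A(1) by (intro symmetric_two_eigenvalues) (auto simp: sym_pattern_def)
  from quad_graph_of_two_eigenvalues[OF assms(1) A(1) this] show ?thesis .
qed

theorem mainTheorem8:
  fixes n :: nat and E :: "nat set set"
  assumes "is_graph n E"
    and "graph_connected n E"
    and "even n" and "n \<ge> 4"
    and "q_graph n E = 2"
    and "card E = 2 * n - 4"
  shows "graph_iso n E 8 Q3_edges \<or> graph_iso n E n (candle_edges (n div 2))"
proof -
  let ?V = "{0..<n}" and ?adj = "\<lambda>u w. {u, w} \<in> E"
  interpret quad_graph ?V ?adj by (rule quad_graph_if_q_two[OF assms(1,5)])
  have "edges = E"
  proof
    show "E \<subseteq> edges"
    proof
      fix e assume "e \<in> E"
      moreover from this obtain i j where "e = {i, j}" using assms(1) unfolding is_graph_def by blast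
      ultimately show "e \<in> edges" unfolding edges_def by blast
    qed
  qed (auto simp: edges_def)
  then have cE: "card edges + 4 = 2 * card ?V" using assms(4,6) by simp
  have levels: "\<exists>L. leveled ?V ?adj r L" if "r \<in> ?V" for r
    using exists_levels[OF that] assms(2) that unfolding graph_connected_def by auto
  have exact: "exact_levels ?V ?adj L" if "leveled ?V ?adj r L" "card {u. ?adj r u} = 2" for r L
    using leveled.exact_if_degree_two[OF that(1) cE] leveled.N_one[OF that(1)] that(2) by simp
  \<comment> \<open>Taking any vertex as root, \<open>edge_excess\<close> makes its degree the
    excess plus 2.\<close>
  have deg2: "2 \<le> card {u. ?adj r u}" if r: "r \<in> ?V" for r
  proof -
    obtain L where L: "leveled ?V ?adj r L" using levels[OF r] by blast
    show ?thesis using leveled.edge_excess[OF L cE] leveled.N_one[OF L] by simp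
  qed
  show ?thesis
  proof (cases "\<exists>r\<in>?V. card {u. ?adj r u} = 2")
    case True
    then obtain r where r: "r \<in> ?V" "card {u. ?adj r u} = 2" by blast
    obtain L where L: "leveled ?V ?adj r L" using levels[OF r(1)] by blast
    have "card {u \<in> ?V. L u = 1} = 2" using leveled.N_one[OF L] r(2) by simp
    then have "\<exists>k. card ?V = 2 * k \<and> 2 \<le> k \<and>
        (\<forall>i. card {u \<in> ?V. L u = i} = (if i = 0 \<or> i = k then 1 else if i < k then 2 else 0)) \<and>
        (\<forall>u w. ?adj u w \<longleftrightarrow> u \<in> ?V \<and> w \<in> ?V \<and> (L u = Suc (L w) \<or> L w = Suc (L u)))"
    proof (rule leveled.candle_levels[OF L exact[OF L r(2)]])
      show "\<exists>M. leveled ?V ?adj z M \<and> exact_levels ?V ?adj M"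
        if z: "z \<in> ?V" "card {u. ?adj z u} = 2" for z
        using levels[OF z(1)] exact[OF _ z(2)] by blast
    qed (use assms(3,4) in simp_all)
    then obtain k where k: "card ?V = 2 * k" "2 \<le> k"
      and lev: "\<And>i. card {u \<in> ?V. L u = i} = (if i = 0 \<or> i = k then 1 else if i < k then 2 else 0)"
      and adj: "\<And>u w. ?adj u w \<longleftrightarrow> u \<in> ?V \<and> w \<in> ?V \<and> (L u = Suc (L w) \<or> L w = Suc (L u))"
      by blast
    have n: "n = 2 * k" using k by simp
    have "graph_iso n E n (candle_edges k)"
      using graph_iso_candle[of k L E] k(2) lev adj unfolding n by simp
    then show ?thesis using n by simp
  next
    case False
    then have deg3: "3 \<le> card {u. ?adj w u}" if "w \<in> ?V" for w
    proof -
      have "card {u. ?adj w u} \<noteq> 2" using False that by blast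
      then show ?thesis using deg2[OF that] by linarith
    qed
    \<comment> \<open>If all degrees were at least 4, the degree sum 4n - 8 would be at least
      4n.\<close>
    have "\<exists>r\<in>?V. card {u. ?adj r u} = 3"
    proof (rule ccontr)
      assume no: "\<not> ?thesis"
      have "(\<Sum>w\<in>?V. 4) \<le> (\<Sum>w\<in>?V. card {u. ?adj w u})"
      proof (rule sum_mono)
        fix w assume w: "w \<in> ?V"
        then have "card {u. ?adj w u} \<noteq> 3" using no by blast
        then show "4 \<le> card {u. ?adj w u}" using deg3[OF w] by linarith
      qed
      then show False using handshake cE assms(4) by simp
    qed
    then obtain r where r: "r \<in> ?V" "card {u. ?adj r u} = 3" by blast
    obtain L where "leveled ?V ?adj r L" using levels[OF r(1)] by blast
    then interpret leveled ?V ?adj r L .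
    have one: "card (N 1) = 3" using N_one r(2) by simp
    let ?R = "{w \<in> ?V. 2 \<le> L w}"
    have excess: "(\<Sum>w\<in>?R. card (pre w) - 2) + card (flat_edges ?adj L) = 1"
      using edge_excess[OF cE] one by simp
    have ge2: "2 \<le> card (pre w)" if "w \<in> ?V" "2 \<le> L w" for w using pre_ge_two that by blast
    show ?thesis
    \<comment> \<open>The single unit of excess is either one flat edge or one surplus predecessor
      at a single vertex \<open>w0\<close>.\<close>
    proof (cases "card (flat_edges ?adj L) = 1")
      case True
      then have "(\<Sum>w\<in>?R. card (pre w) - 2) = 0" using excess by simp
      then have zero: "\<forall>w\<in>?R. card (pre w) - 2 = 0" by (subst (asm) sum_eq_0_iff) simp_all
      have "card (pre w) = 2" if "w \<in> ?V" "2 \<le> L w" for w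
      proof -
        have "card (pre w) - 2 = 0" using zero that by blast
        with ge2[OF that] show ?thesis by linarith
      qed
      then show ?thesis using no_flat_edge[OF deg3 one _ True] by blast
    next
      case False
      then have flat: "card (flat_edges ?adj L) = 0" and sum1: "(\<Sum>w\<in>?R. card (pre w) - 2) = 1"
        using excess by auto
      have "finite ?R" by simp
      from sum1 obtain w0 where w0: "w0 \<in> ?R" "card (pre w0) - 2 = 1"
        "\<And>w. w \<in> ?R \<Longrightarrow> w0 \<noteq> w \<Longrightarrow> card (pre w) - 2 = 0"
        unfolding sum_eq_1_iff[OF \<open>finite ?R\<close>] by blast
      have "\<exists>a1 a2 a3 x1 x2 x3. distinct [r, a1, a2, x1, a3, x2, x3, w0] \<and>
        ?V = {r, a1, a2, x1, a3, x2, x3, w0} \<and>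
        (\<forall>u w. ?adj u w \<longleftrightarrow> {u, w} \<in> {{r, a1}, {r, a2}, {r, a3}, {a1, x1}, {a2, x1}, {a1, x2}, {a3, x2},
          {a2, x3}, {a3, x3}, {x1, w0}, {x2, w0}, {x3, w0}})"
      proof (rule cube_levels[OF deg3 one])
        show "L u \<noteq> L w" if "?adj u w" for u w
          using flat_empty_iff[THEN iffD1, OF flat] that by simp
        show "w0 \<in> ?V" "2 \<le> L w0" using w0(1) by simp_all
        show "card (pre w0) = 3" using w0(2) by linarith
        show "card (pre w) = 2" if "w \<in> ?V" "2 \<le> L w" "w \<noteq> w0" for w
        proof -
          have "card (pre w) - 2 = 0" using w0(3)[of w] that by blast
          with ge2[OF that(1,2)] show ?thesis by linarith
        qed
      qed
      then obtain a1 a2 a3 x1 x2 x3 where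
        "distinct [r, a1, a2, x1, a3, x2, x3, w0]" "?V = {r, a1, a2, x1, a3, x2, x3, w0}"
        "\<forall>u w. ?adj u w \<longleftrightarrow> {u, w} \<in> {{r, a1}, {r, a2}, {r, a3}, {a1, x1}, {a2, x1}, {a1, x2}, {a3, x2},
          {a2, x3}, {a3, x3}, {x1, w0}, {x2, w0}, {x3, w0}}"
        by (elim exE conjE)
      then have "graph_iso n E 8 Q3_edges" by (rule graph_iso_cube)
      then show ?thesis ..
    qed
  qed
qed

end
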